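(* Let $\tau\in\mathbb{H}$, $r\ge1$, and let $k_1,\dots,k_r\ge2$ be integers. For any lattice point $\lambda\in L_\tau$, $$\wp_{k_1,\dots,k_r}(z_1+\lambda,\dots,z_r+\lambda;\tau)=\wp_{k_1,\dots,k_r}(z_1,\dots,z_r;\tau).$$ In particular, the one-variable function $\wp_{k_1,\dots,k_r}(z;\tau)$ is an elliptic function with respect to $L_\tau$ (i.e. meromorphic in $z$ on $\mathbb{C}$ and invariant under $z\mapsto z+1$ and $z\mapsto z+\tau$).
   Context: $\mathbb{H}$ is the upper half-plane, $L_\tau=\mathbb{Z}\tau+\mathbb{Z}$, $\mathbb{Z}_N=\{n\in\mathbb{Z}: |n|<N\}$, and $\mathbb{Z}_M\tau+\mathbb{Z}_N=\{m\tau+n: m\in\mathbb{Z}_M, n\in\mathbb{Z}_N\}$. The order $\prec$ on $L_\tau$: $m_1\tau+n_1\prec m_2\tau+n_2$ iff $m_1<m_2$, or $m_1=m_2$ and $n_1<n_2$. For integers $k_1,\dots,k_r\ge2$, $$\wp_{k_1,\dots,k_r}(z_1,\dots,z_r;\tau)=\lim_{M\to\infty}\lim_{N\to\infty}\sum_{\substack{w_1,\dots,w_r\in\mathbb{Z}_M\tau+\mathbb{Z}_N\\ w_1\prec\dots\prec w_r}}\frac{1}{(z_1-w_1)^{k_1}\cdots(z_r-w_r)^{k_r}},$$ and $\wp_{k_1,\dots,k_r}(z;\tau)=\wp_{k_1,\dots,k_r}(z,\dots,z;\tau)$. *)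

theory Defs
  imports "HOL-Complex_Analysis.Complex_Analysis"
begin

definition lattice :: "complex \<Rightarrow> complex set" where
  "lattice \<tau> = {of_int m * \<tau> + of_int n |m n. True}"

text \<open>The truncation of the lattice to coefficients $|m| < M$, $|n| < N$.\<close>

definition lattice_box :: "complex \<Rightarrow> nat \<Rightarrow> nat \<Rightarrow> complex set" where
  "lattice_box \<tau> M N =
     {of_int m * \<tau> + of_int n |m n. \<bar>m\<bar> < int M \<and> \<bar>n\<bar> < int N}"

definition lattice_less :: "complex \<Rightarrow> complex \<Rightarrow> complex \<Rightarrow> bool" where
  "lattice_less \<tau> w w' \<longleftrightarrow>
     (\<exists>m n m' n'. w = of_int m * \<tau> + of_int n \<and> w' = of_int m' * \<tau> + of_int n' \<and>
        (m < m' \<or> m = m' \<and> n < n'))"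

lemma lattice_coords_unique:
  assumes "Im \<tau> > 0" "of_int m * \<tau> + of_int n = of_int m' * \<tau> + of_int n'"
  shows   "m = m' \<and> n = n'"
proof -
  have "of_int m * Im \<tau> = of_int m' * Im \<tau>"
    using arg_cong[OF assms(2), of Im] by simp
  hence "m = m'" using assms(1) by simp
  thus ?thesis using assms(2) by simp
qed

lemma lattice_less_iff:
  assumes "Im \<tau> > 0"
  shows "lattice_less \<tau> (of_int m * \<tau> + of_int n) (of_int m' * \<tau> + of_int n') \<longleftrightarrow>
           m < m' \<or> m = m' \<and> n < n'"
  unfolding lattice_less_def using lattice_coords_unique[OF assms] by blast

text \<open>The \<open>r\<close>-tuples $w_1 \prec \dots \prec w_r$ in the truncated lattice, as lists.\<close>

definition lattice_chains :: "complex \<Rightarrow> nat \<Rightarrow> nat \<Rightarrow> nat \<Rightarrow> complex list set" where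
  "lattice_chains \<tau> M N r =
     {ws. length ws = r \<and> set ws \<subseteq> lattice_box \<tau> M N \<and> sorted_wrt (lattice_less \<tau>) ws}"

lemma finite_lattice_box: "finite (lattice_box \<tau> M N)"
proof -
  have "lattice_box \<tau> M N \<subseteq>
          (\<lambda>(m,n). of_int m * \<tau> + of_int n) ` ({- int M..int M} \<times> {- int N..int N})"
    unfolding lattice_box_def by force
  thus ?thesis by (rule finite_subset) auto
qed

lemma finite_lattice_chains: "finite (lattice_chains \<tau> M N r)"
  unfolding lattice_chains_def
  by (rule finite_subset[OF _ finite_lists_length_eq[OF finite_lattice_box[of \<tau> M N], of r]])
     auto

text \<open>
  The depth \<open>r\<close> is \<open>length ks\<close>; the list \<open>zs\<close> is meant to have the same length. The function
  is only meaningful when no entry of \<open>zs\<close> is a lattice point: at a lattice point,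
  the convention \<open>1 / 0 = 0\<close> silently drops the singular summands.
\<close>

definition multi_wp :: "complex \<Rightarrow> nat list \<Rightarrow> complex list \<Rightarrow> complex" where
  "multi_wp \<tau> ks zs =
     lim (\<lambda>M. lim (\<lambda>N.
       \<Sum>ws\<in>lattice_chains \<tau> M N (length ks).
         \<Prod>i<length ks. 1 / (zs ! i - ws ! i) ^ (ks ! i)))"

definition multi_wp1 :: "complex \<Rightarrow> nat list \<Rightarrow> complex \<Rightarrow> complex" where
  "multi_wp1 \<tau> ks z = multi_wp \<tau> ks (replicate (length ks) z)"

end

theory Submission
  imports Defs
begin

text \<open>
  An ordered sum over chains \<open>w\<^sub>1 \<prec> \<dots> \<prec> w\<^sub>r\<close> of a product of one-point factors
  \<open>f\<^sub>0(w\<^sub>1) \<cdots> f\<^sub>r\<^sub>-\<^sub>1(w\<^sub>r)\<close> is the corner entry of the ordered product, over all lattice points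
  \<open>w\<close>, of the \<open>(r+1) \<times> (r+1)\<close> matrices \<open>1 + E(w)\<close>, where \<open>E(w)\<close> has the numbers \<open>f\<^sub>a(w)\<close> just
  above the diagonal and zeros elsewhere (\<open>chain_sum_eq_cprod\<close>). The order is lexicographic, so
  this product is a product of row products: the limit over \<open>N\<close> completes each row
  \<open>m\<tau> + \<int>\<close>, and the limit over \<open>M\<close> then multiplies the completed rows. Both limits are
  two-sided infinite products \<open>\<Prod>n\<in>\<int>. (1 + Q(n))\<close> of matrices, and both converge because
  \<open>\<parallel>Q(n)\<parallel> = O(1/n\<^sup>2)\<close>. For such a product the error made by truncating it is at most the error made
  by truncating the scalar product of the numbers \<open>1 + C/(1+|n|)\<^sup>2\<close> (\<open>mnorm_cprod_diff_le\<close>). This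
  gives locally uniform convergence, hence holomorphy (\<open>two_sided_holomorphic\<close>), and invariance
  under a shift of the index (\<open>two_sided_shift\<close>).

  Within a row the decay is that of \<open>1/(z-n)\<^sup>k\<close> with \<open>k \<ge> 2\<close>. For the completed rows, which are
  multitangent functions of \<open>u = z - m\<tau>\<close>, the exponent \<open>k = 2\<close> is delicate
  (\<open>mnorm_multitangent_far_le\<close>). With \<open>y = |Im u|\<close>, one has
  \<open>\<Sum>n. 1/|u-n|\<^sup>2 = O(1/y)\<close>, so every entry built from at least two points of the row is \<open>O(1/y\<^sup>2)\<close>. The
  entries built from a single point are small only through cancellation: \<open>1/(u-n)\<^sup>2\<close> differs from the
  telescoping term \<open>1/(u-n-1) - 1/(u-n)\<close>, whose sum over all \<open>n\<close> vanishes, by a term of size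
  \<open>1/(y |u-n|\<^sup>2)\<close>, so that their sum is \<open>O(1/y\<^sup>2)\<close> as well. As \<open>y\<close> grows linearly in \<open>m\<close>, the rows
  decay like \<open>1/m\<^sup>2\<close>.

  A translation by \<open>s\<tau> + t\<close> shifts the index inside every row by \<open>t\<close> and the index of the rows by
  \<open>s\<close>, which gives the invariance (\<open>wp_matrix_shift\<close>). Near the lattice point \<open>0\<close> only the factor
  of the point \<open>0\<close> is unbounded, and every chain meets it at most once; hence the function
  is bounded by a constant times a negative power of \<open>|z|\<close> and has at most a pole
  (\<open>wp_matrix_pole_bound\<close>). Translation carries this to every lattice point.
\<close>

section \<open>Ordered products of matrices close to the identity\<close>

type_synonym cmat = "nat \<Rightarrow> nat \<Rightarrow> complex"

text \<open>
  The operation with \<open>1 + circ r F G = (1 + F)(1 + G)\<close> for matrices with indices \<open>0, \<dots>, r\<close>. Working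
  with the deviation from the identity matrix makes the zero function a strict neutral element,
  whatever the values at indices above \<open>r\<close>.
\<close>

definition circ :: "nat \<Rightarrow> cmat \<Rightarrow> cmat \<Rightarrow> cmat" where
  "circ r F G = (\<lambda>a b. F a b + G a b + (\<Sum>c\<le>r. F a c * G c b))"

definition cprod :: "nat \<Rightarrow> ('a \<Rightarrow> cmat) \<Rightarrow> 'a list \<Rightarrow> cmat" where
  "cprod r Q xs = foldr (\<lambda>x. circ r (Q x)) xs (\<lambda>_ _. 0)"

definition mnorm :: "nat \<Rightarrow> cmat \<Rightarrow> real" where
  "mnorm r F = (\<Sum>a\<le>r. \<Sum>b\<le>r. norm (F a b))"

lemma cprod_simps [simp]:
  "cprod r Q [] = (\<lambda>_ _. 0)"
  "cprod r Q (x # xs) = circ r (Q x) (cprod r Q xs)"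
  by (simp_all add: cprod_def)

lemma circ_0 [simp]: "circ r (\<lambda>_ _. 0) F = F" "circ r F (\<lambda>_ _. 0) = F"
  by (simp_all add: circ_def)

lemma circ_assoc: "circ r (circ r F G) H = circ r F (circ r G H)"
proof (intro ext)
  fix a b
  have "(\<Sum>c\<le>r. (\<Sum>d\<le>r. F a d * G d c) * H c b) = (\<Sum>d\<le>r. F a d * (\<Sum>c\<le>r. G d c * H c b))"
    by (simp add: sum_distrib_left sum_distrib_right mult.assoc)
       (rule sum.swap)
  then show "circ r (circ r F G) H a b = circ r F (circ r G H) a b"
    by (simp add: circ_def algebra_simps sum.distrib)
qed

lemma cprod_append: "cprod r Q (xs @ ys) = circ r (cprod r Q xs) (cprod r Q ys)"
  by (induction xs) (simp_all add: circ_assoc)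

lemma cprod_concat: "cprod r Q (concat (map g xs)) = cprod r (\<lambda>x. cprod r Q (g x)) xs"
  by (induction xs) (simp_all add: cprod_append)

lemma cprod_map: "cprod r Q (map g xs) = cprod r (\<lambda>x. Q (g x)) xs"
  by (induction xs) simp_all

lemma cprod_cong:
  assumes "\<And>x a b. x \<in> set xs \<Longrightarrow> a \<le> r \<Longrightarrow> b \<le> r \<Longrightarrow> Q x a b = Q' x a b" and "a \<le> r" "b \<le> r"
  shows "cprod r Q xs a b = cprod r Q' xs a b"
  using assms
proof (induction xs arbitrary: a b)
  case (Cons x xs)
  have "cprod r Q xs i j = cprod r Q' xs i j" if "i \<le> r" "j \<le> r" for i j
    using Cons that by auto
  then show ?case using Cons.prems by (simp add: circ_def)
qed simp

lemma mnorm_nonneg [simp]: "0 \<le> mnorm r F"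
  by (simp add: mnorm_def sum_nonneg)

lemma mnorm_0 [simp]: "mnorm r (\<lambda>_ _. 0) = 0"
  by (simp add: mnorm_def)

lemma norm_entry_le_mnorm:
  assumes "a \<le> r" "b \<le> r"
  shows "norm (F a b) \<le> mnorm r F"
proof -
  have "norm (F a b) \<le> (\<Sum>b\<le>r. norm (F a b))"
    by (rule member_le_sum) (use assms in auto)
  also have "\<dots> \<le> mnorm r F"
    unfolding mnorm_def
    by (rule member_le_sum[of _ _ "\<lambda>a. \<Sum>b\<le>r. norm (F a b)"]) (use assms in \<open>auto intro: sum_nonneg\<close>)
  finally show ?thesis .
qed

lemma mnorm_add_le: "mnorm r (\<lambda>a b. F a b + G a b) \<le> mnorm r F + mnorm r G"
  unfolding mnorm_def sum.distrib[symmetric] by (intro sum_mono norm_triangle_ineq)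

lemma mnorm_mult_le: "mnorm r (\<lambda>a b. \<Sum>c\<le>r. F a c * G c b) \<le> mnorm r F * mnorm r G"
proof -
  have "mnorm r (\<lambda>a b. \<Sum>c\<le>r. F a c * G c b)
        \<le> (\<Sum>a\<le>r. \<Sum>b\<le>r. \<Sum>c\<le>r. norm (F a c) * norm (G c b))"
    unfolding mnorm_def norm_mult[symmetric] by (intro sum_mono norm_sum)
  also have "\<dots> = (\<Sum>a\<le>r. \<Sum>c\<le>r. norm (F a c) * (\<Sum>b\<le>r. norm (G c b)))"
    by (rule sum.cong[OF refl], unfold sum_distrib_left) (rule sum.swap)
  also have "\<dots> \<le> (\<Sum>a\<le>r. \<Sum>c\<le>r. norm (F a c) * mnorm r G)"
    unfolding mnorm_def
    by (intro sum_mono mult_left_mono member_le_sum[of _ _ "\<lambda>a. \<Sum>b\<le>r. norm (G a b)"])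
       (auto intro: sum_nonneg)
  also have "\<dots> = mnorm r F * mnorm r G"
    by (simp add: mnorm_def sum_distrib_right)
  finally show ?thesis .
qed

lemma mnorm_circ_diff_left:
  "mnorm r (\<lambda>a b. circ r F G a b - G a b) \<le> mnorm r F * (1 + mnorm r G)"
proof -
  have "mnorm r (\<lambda>a b. circ r F G a b - G a b)
          = mnorm r (\<lambda>a b. F a b + (\<Sum>c\<le>r. F a c * G c b))"
    by (simp add: circ_def)
  also have "\<dots> \<le> mnorm r F + mnorm r F * mnorm r G"
    using mnorm_add_le mnorm_mult_le by (rule order_trans[OF _ add_left_mono])
  finally show ?thesis by (simp add: algebra_simps)
qed

lemma mnorm_circ_diff_right:
  "mnorm r (\<lambda>a b. circ r F G a b - F a b) \<le> mnorm r G * (1 + mnorm r F)"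
proof -
  have "mnorm r (\<lambda>a b. circ r F G a b - F a b)
          = mnorm r (\<lambda>a b. G a b + (\<Sum>c\<le>r. F a c * G c b))"
    by (simp add: circ_def)
  also have "\<dots> \<le> mnorm r G + mnorm r F * mnorm r G"
    using mnorm_add_le mnorm_mult_le by (rule order_trans[OF _ add_left_mono])
  finally show ?thesis by (simp add: algebra_simps)
qed

lemma mnorm_circ_le: "1 + mnorm r (circ r F G) \<le> (1 + mnorm r F) * (1 + mnorm r G)"
proof -
  have "mnorm r (circ r F G) = mnorm r (\<lambda>a b. (circ r F G a b - G a b) + G a b)"
    by simp
  also have "\<dots> \<le> mnorm r F * (1 + mnorm r G) + mnorm r G"
    using mnorm_circ_diff_left by (rule order_trans[OF mnorm_add_le add_right_mono])
  finally show ?thesis by (simp add: algebra_simps)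
qed

lemma mnorm_cprod_le:
  assumes "\<And>x. x \<in> set xs \<Longrightarrow> mnorm r (Q x) \<le> b x"
  shows "1 + mnorm r (cprod r Q xs) \<le> (\<Prod>x\<leftarrow>xs. 1 + b x)"
  using assms
proof (induction xs)
  case (Cons x xs)
  have "1 + mnorm r (cprod r Q (x # xs)) \<le> (1 + mnorm r (Q x)) * (1 + mnorm r (cprod r Q xs))"
    by (simp add: mnorm_circ_le)
  also have "\<dots> \<le> (1 + b x) * (\<Prod>x\<leftarrow>xs. 1 + b x)"
    using Cons order_trans[OF mnorm_nonneg Cons.prems[of x]]
    by (intro mult_mono) (auto intro: add_nonneg_nonneg)
  finally show ?case by simp
qed simp

text \<open>
  Enlarging a product on both sides changes it by no more than the same enlargement changes the
  scalar majorant. Writing the long product as \<open>X Y Z\<close>, the change is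
  \<open>(X - 1) Y Z + Y (Z - 1)\<close>, and bounding each factor by its majorant makes the sum telescope to a
  difference of two scalar products. Convergence questions thus reduce to a monotone sequence of
  real numbers.
\<close>

lemma mnorm_cprod_diff_le:
  fixes b :: "'a \<Rightarrow> real"
  assumes "\<And>x. mnorm r (Q x) \<le> b x"
  shows "mnorm r (\<lambda>a b. cprod r Q (xs @ ys @ zs) a b - cprod r Q ys a b)
         \<le> (\<Prod>x\<leftarrow>xs @ ys @ zs. 1 + b x) - (\<Prod>x\<leftarrow>ys. 1 + b x)"
proof -
  let ?p = "\<lambda>xs. \<Prod>x\<leftarrow>xs. 1 + b x"
  let ?X = "cprod r Q xs" and ?Y = "cprod r Q ys" and ?Z = "cprod r Q zs"
  note B = mnorm_cprod_le[of _ r Q b, OF assms]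
  have B': "mnorm r (cprod r Q xs) \<le> ?p xs - 1" for xs using B[of xs] by linarith
  have p1: "1 \<le> ?p xs" for xs
    by (rule order_trans[OF _ B]) simp
  have "mnorm r (\<lambda>a b. cprod r Q (xs @ ys @ zs) a b - ?Y a b)
      = mnorm r (\<lambda>a b. (circ r ?X (circ r ?Y ?Z) a b - circ r ?Y ?Z a b)
                        + (circ r ?Y ?Z a b - ?Y a b))"
    by (simp add: cprod_append)
  also have "\<dots> \<le> mnorm r ?X * (1 + mnorm r (circ r ?Y ?Z)) + mnorm r ?Z * (1 + mnorm r ?Y)"
    by (rule order_trans[OF mnorm_add_le add_mono[OF mnorm_circ_diff_left mnorm_circ_diff_right]])
  also have "\<dots> \<le> (?p xs - 1) * (?p ys * ?p zs) + (?p zs - 1) * ?p ys"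
    using B'[of xs] B[of "ys @ zs"] B'[of zs] B[of ys] p1[of xs] p1[of zs]
    by (intro add_mono mult_mono) (auto simp: cprod_append)
  also have "\<dots> = ?p (xs @ ys @ zs) - ?p ys"
    by (simp add: algebra_simps)
  finally show ?thesis .
qed

text \<open>
  Apart from its linear part, a product is of second order in the size of its factors. This is
  what separates the single-point contributions of a row, which need cancellation, from all
  others, for which absolute values suffice.
\<close>

lemma mnorm_cprod_minus_sum_le:
  fixes b :: "'a \<Rightarrow> real"
  assumes "\<And>x. x \<in> set xs \<Longrightarrow> mnorm r (Q x) \<le> b x"
  shows "mnorm r (\<lambda>i j. cprod r Q xs i j - (\<Sum>x\<leftarrow>xs. Q x i j))
         \<le> (\<Prod>x\<leftarrow>xs. 1 + b x) - 1 - (\<Sum>x\<leftarrow>xs. b x)"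
  using assms
proof (induction xs)
  case (Cons x xs)
  let ?P = "cprod r Q xs" and ?p = "\<Prod>x\<leftarrow>xs. 1 + b x"
  have "mnorm r (\<lambda>i j. cprod r Q (x # xs) i j - (\<Sum>x\<leftarrow>x # xs. Q x i j))
     = mnorm r (\<lambda>i j. (?P i j - (\<Sum>x\<leftarrow>xs. Q x i j)) + (\<Sum>c\<le>r. Q x i c * ?P c j))"
    by (simp add: circ_def algebra_simps)
  also have "\<dots> \<le> (?p - 1 - (\<Sum>x\<leftarrow>xs. b x)) + mnorm r (Q x) * mnorm r ?P"
    using Cons by (intro order_trans[OF mnorm_add_le add_mono[OF _ mnorm_mult_le]]) auto
  also have "mnorm r (Q x) * mnorm r ?P \<le> b x * (?p - 1)"
    using mnorm_cprod_le[of xs r Q b] Cons.prems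
    by (intro mult_mono) (auto intro: order_trans[OF mnorm_nonneg])
  finally show ?case by (simp add: algebra_simps)
qed simp

section \<open>Chain sums as matrix entries\<close>

definition step_matrix :: "(nat \<Rightarrow> 'a \<Rightarrow> complex) \<Rightarrow> 'a \<Rightarrow> cmat" where
  "step_matrix f x = (\<lambda>a b. if b = Suc a then f a x else 0)"

lemma cprod_step_matrix_Cons:
  "cprod r (step_matrix f) (x # xs) a b =
     (if b = Suc a then f a x else 0) + cprod r (step_matrix f) xs a b +
     (if a < r then f a x * cprod r (step_matrix f) xs (Suc a) b else 0)"
proof -
  have "(\<Sum>c\<le>r. step_matrix f x a c * cprod r (step_matrix f) xs c b)
      = (\<Sum>c\<le>r. if c = Suc a then f a x * cprod r (step_matrix f) xs c b else 0)"
    by (intro sum.cong) (auto simp: step_matrix_def)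
  then show ?thesis by (auto simp: circ_def step_matrix_def)
qed

text \<open>
  All deviations are strictly upper triangular.
\<close>

lemma cprod_step_matrix_lower:
  "b \<le> a \<Longrightarrow> cprod r (step_matrix f) xs a b = 0"
  by (induction xs arbitrary: a) (auto simp: cprod_step_matrix_Cons simp del: cprod_simps(2))

definition ordered_tuples :: "('a \<Rightarrow> 'a \<Rightarrow> bool) \<Rightarrow> 'a set \<Rightarrow> nat \<Rightarrow> 'a list set" where
  "ordered_tuples R A l = {ws. length ws = l \<and> set ws \<subseteq> A \<and> sorted_wrt R ws}"

lemma finite_ordered_tuples: "finite A \<Longrightarrow> finite (ordered_tuples R A l)"
  unfolding ordered_tuples_def
  by (rule finite_subset[OF _ finite_lists_length_eq[of A l]]) auto

text \<open>
  A least element can only occur at the head of a chain.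
\<close>

lemma ordered_tuples_insert_least:
  assumes least: "\<And>y. y \<in> A \<Longrightarrow> R x y" and asym: "\<And>y z. R y z \<Longrightarrow> \<not> R z y"
  shows "ordered_tuples R (insert x A) (Suc l) = ordered_tuples R A (Suc l) \<union> (#) x ` ordered_tuples R A l"
proof (intro equalityI subsetI)
  fix ws assume "ws \<in> ordered_tuples R (insert x A) (Suc l)"
  then obtain v vs where ws: "ws = v # vs" and len: "length vs = l"
    and sub: "v \<in> insert x A" "set vs \<subseteq> insert x A"
    and srt: "\<forall>y\<in>set vs. R v y" "sorted_wrt R vs"
    by (cases ws) (auto simp: ordered_tuples_def)
  have "x \<notin> set vs"
    using sub(1) srt(1) least asym by blast
  then have "set vs \<subseteq> A" using sub(2) by auto
  then show "ws \<in> ordered_tuples R A (Suc l) \<union> (#) x ` ordered_tuples R A l"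
    using sub(1) srt ws len by (auto simp: ordered_tuples_def)
next
  fix ws assume "ws \<in> ordered_tuples R A (Suc l) \<union> (#) x ` ordered_tuples R A l"
  then show "ws \<in> ordered_tuples R (insert x A) (Suc l)"
    using least by (auto 0 3 simp: ordered_tuples_def)
qed

text \<open>
  Expanding the ordered product, the entry \<open>(a, a + l)\<close> has to climb \<open>l\<close> steps along the
  superdiagonal, and each factor contributes at most one step; the points at which steps are taken
  form a chain. The induction adds a new least point to the list.
\<close>

lemma chain_sum_eq_cprod:
  assumes "sorted_wrt R xs" and asym: "\<And>y z. R y z \<Longrightarrow> \<not> R z y" and "0 < l" "a + l \<le> r"
  shows "(\<Sum>ws\<in>ordered_tuples R (set xs) l. \<Prod>i<l. f (a + i) (ws ! i))
         = cprod r (step_matrix f) xs a (a + l)"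
  using assms(1,3,4)
proof (induction xs arbitrary: a l)
  case Nil
  then have "ordered_tuples R (set []) l = {}" by (auto simp: ordered_tuples_def)
  then show ?case by simp
next
  case (Cons x xs)
  let ?C = "ordered_tuples R (set xs)" and ?T = "\<lambda>a l ws. \<Prod>i<l. f (a + i) (ws ! i)"
  obtain l' where l: "l = Suc l'" using Cons.prems by (cases l) auto
  have nin: "x \<notin> set xs" using Cons.prems(1) asym by auto
  have eq: "ordered_tuples R (set (x # xs)) l = ?C l \<union> (#) x ` ?C l'"
    unfolding l list.set using Cons.prems(1) asym by (intro ordered_tuples_insert_least) auto
  have "(\<Sum>ws\<in>ordered_tuples R (set (x # xs)) l. ?T a l ws)
      = (\<Sum>ws\<in>?C l. ?T a l ws) + (\<Sum>ws\<in>(#) x ` ?C l'. ?T a l ws)"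
  proof -
    have "?C l \<inter> (#) x ` ?C l' = {}" using nin by (auto simp: ordered_tuples_def)
    then show ?thesis unfolding eq by (intro sum.union_disjoint) (simp_all add: finite_ordered_tuples)
  qed
  also have "(\<Sum>ws\<in>?C l. ?T a l ws) = cprod r (step_matrix f) xs a (a + l)"
    using Cons by (intro Cons.IH) auto
  also have "(\<Sum>ws\<in>(#) x ` ?C l'. ?T a l ws) = (\<Sum>ws\<in>?C l'. f a x * ?T (Suc a) l' ws)"
    unfolding l prod.lessThan_Suc_shift by (subst sum.reindex) (auto simp: inj_on_def)
  also have "\<dots> = f a x * (\<Sum>ws\<in>?C l'. ?T (Suc a) l' ws)"
    by (simp add: sum_distrib_left)
  also have "f a x * (\<Sum>ws\<in>?C l'. ?T (Suc a) l' ws) =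
     (if l' = 0 then f a x else 0) + f a x * cprod r (step_matrix f) xs (Suc a) (a + l)"
  proof (cases "l' = 0")
    case True
    have "?C l' = {[]}" using True by (auto simp: ordered_tuples_def)
    then show ?thesis using True l by (simp add: cprod_step_matrix_lower)
  next
    case False
    then show ?thesis using Cons.prems l Cons.IH[of l' "Suc a"] by simp
  qed
  also have "cprod r (step_matrix f) xs a (a + l) + \<dots> = cprod r (step_matrix f) (x # xs) a (a + l)"
    unfolding cprod_step_matrix_Cons using Cons.prems l by auto
  finally show ?case .
qed

section \<open>Two-sided infinite products\<close>

definition window :: "nat \<Rightarrow> int list" where
  "window N = [1 - int N..int N - 1]"

definition two_sided :: "nat \<Rightarrow> (int \<Rightarrow> cmat) \<Rightarrow> cmat" where
  "two_sided r Q = (\<lambda>a b. lim (\<lambda>N. cprod r Q (window N) a b))"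

lemma two_sided_cong:
  assumes "\<And>n a b. a \<le> r \<Longrightarrow> b \<le> r \<Longrightarrow> Q n a b = Q' n a b" and "a \<le> r" "b \<le> r"
  shows "two_sided r Q a b = two_sided r Q' a b"
proof -
  have "cprod r Q (window N) a b = cprod r Q' (window N) a b" for N
    by (rule cprod_cong) (use assms in auto)
  then show ?thesis by (simp add: two_sided_def)
qed

text \<open>
  The model of a summable two-sided sequence; every estimate below has the form
  \<open>constant * weight n\<close>.
\<close>

definition weight :: "int \<Rightarrow> real" where
  "weight n = 1 / (1 + real_of_int \<bar>n\<bar>)\<^sup>2"

lemma weight_nonneg [simp]: "0 \<le> weight n"
  by (simp add: weight_def)

lemma weight_0 [simp]: "weight 0 = 1"
  by (simp add: weight_def)

lemma set_window [simp]: "set (window N) = {1 - int N..int N - 1}"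
  by (simp add: window_def)

lemma distinct_window [simp]: "distinct (window N)"
  by (simp add: window_def)

lemma upto_extend:
  assumes "p' \<le> p" "q \<le> q'" "p \<le> q + 1"
  obtains xs zs where "[p'..q'] = xs @ [p..q] @ zs"
proof -
  have "[p'..q'] = [p'..p - 1] @ [p..q']"
  proof (cases "p \<le> q'")
    case True
    then show ?thesis using assms by (intro upto_split1)
  next
    case False
    then have "q' = p - 1" using assms by simp
    then show ?thesis by simp
  qed
  moreover have "[p..q'] = [p..q] @ [q + 1..q']"
  proof (cases "p \<le> q")
    case True
    then show ?thesis using assms by (intro upto_split2)
  next
    case False
    then have "p = q + 1" using assms by simp
    then show ?thesis by simp
  qed
  ultimately show ?thesis using that by metis
qed

text \<open>
  Comparison of \<open>2/(N+1)\<^sup>2\<close>, the contribution of the two new end points, with the telescoping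
  \<open>2/N - 2/(N+1)\<close>.
\<close>

lemma sum_weight_window_le: "(\<Sum>n\<leftarrow>window N. weight n) \<le> 3"
proof -
  have "(\<Sum>n\<in>{1 - int (Suc N)..int (Suc N) - 1}. weight n) \<le> 3 - 2 / real (Suc N)" for N
  proof (induction N)
    case (Suc N)
    have eq: "{1 - int (Suc (Suc N))..int (Suc (Suc N)) - 1} =
          insert (- int (Suc N)) (insert (int (Suc N)) {1 - int (Suc N)..int (Suc N) - 1})"
      by auto
    have "(\<Sum>n\<in>{1 - int (Suc (Suc N))..int (Suc (Suc N)) - 1}. weight n)
        \<le> 3 - 2 / real (Suc N) + 2 / (real N + 2)\<^sup>2"
      unfolding eq using Suc by (simp add: weight_def add_ac)
    also have "2 / (real N + 2)\<^sup>2 \<le> 2 / ((real N + 1) * (real N + 2))"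
      unfolding power2_eq_square by (intro divide_left_mono mult_mono mult_pos_pos) auto
    also have "2 / ((real N + 1) * (real N + 2)) = 2 / real (Suc N) - 2 / real (Suc (Suc N))"
      by (simp add: diff_frac_eq add_ac)
    finally show ?case by simp
  qed simp
  moreover have "(\<Sum>n\<leftarrow>window N. weight n) = (\<Sum>n\<in>{1 - int N..int N - 1}. weight n)"
    by (subst sum_list_distinct_conv_sum_set) auto
  moreover have "3 - 2 / real (Suc N) \<le> 3" for N
    by simp
  ultimately show ?thesis
    by (cases N) (simp, metis order_trans)
qed

lemma prod_list_one_plus_le_exp:
  fixes b :: "'a \<Rightarrow> real"
  assumes "\<And>x. 0 \<le> b x"
  shows "(\<Prod>x\<leftarrow>xs. 1 + b x) \<le> exp (\<Sum>x\<leftarrow>xs. b x)"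
proof (induction xs)
  case (Cons x xs)
  have "0 \<le> (\<Prod>x\<leftarrow>xs. 1 + b x)"
    using assms by (intro prod_list_nonneg) (auto intro: add_nonneg_nonneg)
  then have "(1 + b x) * (\<Prod>x\<leftarrow>xs. 1 + b x) \<le> exp (b x) * exp (\<Sum>x\<leftarrow>xs. b x)"
    using Cons assms by (intro mult_mono) auto
  then show ?case by (simp add: exp_add)
qed simp

lemma prod_list_one_plus_mono:
  fixes b :: "'a \<Rightarrow> real"
  assumes "\<And>x. 0 \<le> b x"
  shows "(\<Prod>x\<leftarrow>ys. 1 + b x) \<le> (\<Prod>x\<leftarrow>xs @ ys @ zs. 1 + b x)"
proof -
  have ge1: "1 \<le> (\<Prod>x\<leftarrow>xs. 1 + b x)" for xs
  proof (induction xs)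
    case (Cons x xs)
    then have "1 * 1 \<le> (1 + b x) * (\<Prod>x\<leftarrow>xs. 1 + b x)"
      using assms[of x] by (intro mult_mono) auto
    then show ?case by simp
  qed simp
  have "1 * ((\<Prod>x\<leftarrow>ys. 1 + b x) * 1)
      \<le> (\<Prod>x\<leftarrow>xs. 1 + b x) * ((\<Prod>x\<leftarrow>ys. 1 + b x) * (\<Prod>x\<leftarrow>zs. 1 + b x))"
    using ge1[of xs] ge1[of ys] ge1[of zs] by (intro mult_mono) auto
  then show ?thesis by simp
qed

definition majorant :: "real \<Rightarrow> int list \<Rightarrow> real" where
  "majorant C xs = (\<Prod>n\<leftarrow>xs. 1 + C * weight n)"

lemma window_extend:
  assumes "M \<le> N"
  obtains xs zs where "window N = xs @ window M @ zs"
proof (cases M)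
  case 0
  then have "window N = window N @ window M @ []" by (simp add: window_def)
  then show ?thesis using that by blast
next
  case (Suc m)
  show ?thesis unfolding window_def
    by (rule upto_extend[of "1 - int N" "1 - int M" "int M - 1" "int N - 1"])
       (use that assms Suc in \<open>auto simp: window_def\<close>)
qed

lemma majorant_window_le:
  assumes "0 \<le> C"
  shows "majorant C (window N) \<le> exp (3 * C)"
proof -
  have "majorant C (window N) \<le> exp (C * (\<Sum>n\<leftarrow>window N. weight n))"
    unfolding majorant_def sum_list_const_mult[symmetric]
    by (rule prod_list_one_plus_le_exp) (use assms in auto)
  also have "\<dots> \<le> exp (C * 3)"
    using assms sum_weight_window_le by (simp add: mult_left_mono)
  finally show ?thesis by (simp add: mult.commute)
qed

lemma convergent_majorant_window:
  assumes "0 \<le> C"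
  shows "convergent (\<lambda>N. majorant C (window N))"
proof -
  have "incseq (\<lambda>N. majorant C (window N))"
  proof (intro incseq_SucI)
    fix N
    obtain xs zs where "window (Suc N) = xs @ window N @ zs"
      using window_extend[of N "Suc N"] by auto
    then show "majorant C (window N) \<le> majorant C (window (Suc N))"
      unfolding majorant_def using assms prod_list_one_plus_mono[of "\<lambda>n. C * weight n"] by simp
  qed
  then show ?thesis
    using incseq_convergent majorant_window_le[OF assms] unfolding convergent_def by metis
qed

text \<open>
  The form in which the comparison with the scalar product is applied to windows.
\<close>

lemma norm_cprod_extend_le:
  assumes "\<And>n. mnorm r (Q n) \<le> C * weight n" "a \<le> r" "b \<le> r"
  shows "norm (cprod r Q (xs @ ys @ zs) a b - cprod r Q ys a b)
         \<le> majorant C (xs @ ys @ zs) - majorant C ys"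
  unfolding majorant_def
  by (rule order_trans[OF norm_entry_le_mnorm[OF assms(2,3)]
        mnorm_cprod_diff_le[of r Q "\<lambda>n. C * weight n", OF assms(1)]])

lemma decay_const_nonneg:
  assumes "\<And>n. mnorm r (Q n) \<le> C * weight n"
  shows "0 \<le> C"
  using order_trans[OF mnorm_nonneg assms[of 0]] by simp

text \<open>
  The bound on the difference of two partial products does not involve the parameter \<open>x\<close>, so the
  Cauchy property of the scalar majorants is uniform in \<open>x\<close>.
\<close>

lemma uniform_limit_two_sided:
  assumes decay: "\<And>x n. x \<in> S \<Longrightarrow> mnorm r (Q x n) \<le> C * weight n" and ab: "a \<le> r" "b \<le> r"
  shows "uniform_limit S (\<lambda>N x. cprod r (Q x) (window N) a b) (\<lambda>x. two_sided r (Q x) a b) sequentially"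
proof (cases "S = {}")
  case False
  then obtain x0 where "x0 \<in> S" by auto
  then have C: "0 \<le> C" using decay_const_nonneg decay by blast
  have Cauchy: "Cauchy (\<lambda>N. majorant C (window N))"
    using convergent_majorant_window[OF C] by (rule convergent_Cauchy)
  have "uniformly_Cauchy_on S (\<lambda>N x. cprod r (Q x) (window N) a b)"
  proof (rule uniformly_Cauchy_onI')
    fix e :: real assume "e > 0"
    with Cauchy obtain N0 where
      N0: "\<And>M N. M \<ge> N0 \<Longrightarrow> N \<ge> N0 \<Longrightarrow> dist (majorant C (window M)) (majorant C (window N)) < e"
      by (metis metric_CauchyD)
    show "\<exists>N0. \<forall>x\<in>S. \<forall>M\<ge>N0. \<forall>N>M.
       dist (cprod r (Q x) (window M) a b) (cprod r (Q x) (window N) a b) < e"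
    proof (intro exI[of _ N0] ballI allI impI)
      fix x M N assume x: "x \<in> S" and MN: "N0 \<le> M" "M < N"
      obtain xs zs where ext: "window N = xs @ window M @ zs"
        using window_extend[of M N] MN by auto
      have "dist (cprod r (Q x) (window M) a b) (cprod r (Q x) (window N) a b)
          \<le> majorant C (window N) - majorant C (window M)"
        unfolding ext dist_norm norm_minus_commute[of "cprod r (Q x) (window M) a b"]
        by (rule norm_cprod_extend_le) (use decay x ab in auto)
      also have "\<dots> < e" using N0[of M N] MN by (simp add: dist_real_def)
      finally show "dist (cprod r (Q x) (window M) a b) (cprod r (Q x) (window N) a b) < e" .
    qed
  qed
  then show ?thesis
    unfolding two_sided_def
    using Cauchy_uniformly_convergent uniformly_convergent_uniform_limit_iff by blast
qed simp

lemma tendsto_two_sided: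
  assumes "\<And>n. mnorm r (Q n) \<le> C * weight n" "a \<le> r" "b \<le> r"
  shows "(\<lambda>N. cprod r Q (window N) a b) \<longlonglongrightarrow> two_sided r Q a b"
  using tendsto_uniform_limitI[OF uniform_limit_two_sided[of "{()}" r "\<lambda>_. Q" C a b]] assms by auto

text \<open>
  A shifted window lies between the windows whose radii differ from its own by \<open>|t|\<close>. The
  majorants of these two have the same limit, so the partial products over shifted and centred
  windows have the same limit as well.
\<close>

lemma two_sided_shift:
  assumes decay: "\<And>n. mnorm r (Q n) \<le> C * weight n" and ab: "a \<le> r" "b \<le> r"
  shows "two_sided r (\<lambda>n. Q (n - t)) a b = two_sided r Q a b"
proof -
  define T where "T = nat \<bar>t\<bar>"
  define shifted where "shifted N = [1 - int N - t..int N - 1 - t]" for N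
  have map_shift: "map (\<lambda>n. n - t) (window N) = shifted N" for N
    unfolding window_def shifted_def
    by (rule nth_equalityI) (auto simp: nth_upto)
  have C: "0 \<le> C" using decay_const_nonneg decay by blast
  have bound: "norm (cprod r Q (window (N + T)) a b - cprod r Q (shifted N) a b)
      \<le> majorant C (window (N + T)) - majorant C (window (N - T))" if "N > T" for N
  proof -
    obtain xs zs where 1: "window (N + T) = xs @ shifted N @ zs"
      unfolding window_def shifted_def
      by (rule upto_extend[of "1 - int (N + T)" "1 - int N - t" "int N - 1 - t" "int (N + T) - 1"])
         (use \<open>N > T\<close> in \<open>auto simp: T_def\<close>)
    obtain xs' zs' where 2: "shifted N = xs' @ window (N - T) @ zs'"
      unfolding window_def shifted_def
      by (rule upto_extend[of "1 - int N - t" "1 - int (N - T)" "int (N - T) - 1" "int N - 1 - t"])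
         (use \<open>N > T\<close> in \<open>auto simp: T_def\<close>)
    have "norm (cprod r Q (window (N + T)) a b - cprod r Q (shifted N) a b)
        \<le> majorant C (window (N + T)) - majorant C (shifted N)"
      unfolding 1 by (rule norm_cprod_extend_le) (use decay ab in auto)
    moreover have "majorant C (window (N - T)) \<le> majorant C (shifted N)"
      unfolding 2 majorant_def using C by (intro prod_list_one_plus_mono) auto
    ultimately show ?thesis by linarith
  qed
  obtain L where L: "(\<lambda>N. majorant C (window N)) \<longlonglongrightarrow> L"
    using convergent_majorant_window[OF C] by (auto simp: convergent_def)
  have "(\<lambda>N. majorant C (window (N - T))) \<longlonglongrightarrow> L"
    by (rule LIMSEQ_offset[of _ T]) (simp add: L)
  then have "(\<lambda>N. majorant C (window (N + T)) - majorant C (window (N - T))) \<longlonglongrightarrow> 0"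
    using tendsto_diff[OF LIMSEQ_ignore_initial_segment[OF L, of T]] by fastforce
  then have "(\<lambda>N. cprod r Q (window (N + T)) a b - cprod r Q (shifted N) a b) \<longlonglongrightarrow> 0"
    by (rule Lim_null_comparison[rotated])
       (use bound in \<open>auto simp: eventually_sequentially intro!: exI[of _ "Suc T"]\<close>)
  from tendsto_diff[OF LIMSEQ_ignore_initial_segment[OF tendsto_two_sided[of r Q C a b], of T] this]
  have "(\<lambda>N. cprod r Q (shifted N) a b) \<longlonglongrightarrow> two_sided r Q a b"
    using decay ab by simp
  moreover have "cprod r (\<lambda>n. Q (n - t)) (window N) = cprod r Q (shifted N)" for N
    by (simp flip: map_shift add: cprod_map)
  ultimately show ?thesis
    unfolding two_sided_def[of r "\<lambda>n. Q (n - t)"] by (simp add: limI)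
qed

lemma tendsto_mnorm:
  assumes "\<And>a b. a \<le> r \<Longrightarrow> b \<le> r \<Longrightarrow> ((\<lambda>N. F N a b) \<longlongrightarrow> G a b) net"
  shows "((\<lambda>N. mnorm r (F N)) \<longlongrightarrow> mnorm r G) net"
  unfolding mnorm_def using assms by (intro tendsto_sum tendsto_norm) auto

text \<open>
  One factor may be arbitrarily large and then enters the bound only linearly. Near a pole, the
  large factor is the one of the singular lattice point.
\<close>

lemma mnorm_two_sided_le:
  assumes "\<And>n. n \<noteq> 0 \<Longrightarrow> mnorm r (Q n) \<le> C * weight n" "0 \<le> C"
  shows "1 + mnorm r (two_sided r Q) \<le> (1 + mnorm r (Q 0)) * exp (3 * C)"
proof (rule LIMSEQ_le_const2)
  have "mnorm r (Q n) \<le> max C (mnorm r (Q 0)) * weight n" for n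
  proof (cases "n = 0")
    case False
    have "C * weight n \<le> max C (mnorm r (Q 0)) * weight n"
      by (intro mult_right_mono) auto
    with assms(1)[OF False] show ?thesis by linarith
  qed simp
  then show "(\<lambda>N. 1 + mnorm r (cprod r Q (window N))) \<longlonglongrightarrow> 1 + mnorm r (two_sided r Q)"
    by (intro tendsto_add tendsto_const tendsto_mnorm tendsto_two_sided)
  have "1 + mnorm r (cprod r Q (window N)) \<le> (1 + mnorm r (Q 0)) * exp (3 * C)" for N
  proof -
    let ?W = "{1 - int N..int N - 1}"
    have "1 + mnorm r (cprod r Q (window N)) \<le> (\<Prod>n\<leftarrow>window N. 1 + mnorm r (Q n))"
      by (rule mnorm_cprod_le) simp
    also have "\<dots> = (\<Prod>n\<in>?W. 1 + mnorm r (Q n))"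
      by (simp add: prod.distinct_set_conv_list[symmetric])
    also have "\<dots> \<le> (\<Prod>n\<in>?W. (if n = 0 then 1 + mnorm r (Q 0) else 1) * (1 + C * weight n))"
    proof (rule prod_mono)
      fix n
      have "(1 + mnorm r (Q 0)) * 1 \<le> (1 + mnorm r (Q 0)) * (1 + C * weight 0)"
        using assms(2) by (intro mult_left_mono) auto
      then show "0 \<le> 1 + mnorm r (Q n) \<and>
        1 + mnorm r (Q n) \<le> (if n = 0 then 1 + mnorm r (Q 0) else 1) * (1 + C * weight n)"
        using assms(1)[of n] by auto
    qed
    also have "\<dots> \<le> (1 + mnorm r (Q 0)) * (\<Prod>n\<in>?W. 1 + C * weight n)"
      using assms(2) by (auto simp: prod.distrib intro!: mult_right_mono prod_nonneg)
    also have "(\<Prod>n\<in>?W. 1 + C * weight n) = majorant C (window N)"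
      by (simp add: majorant_def prod.distinct_set_conv_list[symmetric])
    also have "\<dots> \<le> exp (3 * C)" by (rule majorant_window_le) (rule assms)
    finally show ?thesis by (simp add: mult_left_mono)
  qed
  then show "\<exists>N0. \<forall>N\<ge>N0. 1 + mnorm r (cprod r Q (window N)) \<le> (1 + mnorm r (Q 0)) * exp (3 * C)"
    by blast
qed

lemma cprod_holomorphic:
  assumes "\<And>x a b. x \<in> set xs \<Longrightarrow> a \<le> r \<Longrightarrow> b \<le> r \<Longrightarrow> (\<lambda>z. Q z x a b) holomorphic_on S"
    and "a \<le> r" "b \<le> r"
  shows "(\<lambda>z. cprod r (Q z) xs a b) holomorphic_on S"
  using assms
proof (induction xs arbitrary: a b)
  case (Cons x xs)
  show ?case unfolding cprod_simps circ_def
    by (intro holomorphic_intros Cons.IH Cons.prems) (use Cons.prems in auto)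
qed simp

lemma tendsto_cprod:
  assumes "\<And>x a b. x \<in> set xs \<Longrightarrow> a \<le> r \<Longrightarrow> b \<le> r \<Longrightarrow> ((\<lambda>N. Q N x a b) \<longlongrightarrow> P x a b) net"
    and "a \<le> r" "b \<le> r"
  shows "((\<lambda>N. cprod r (Q N) xs a b) \<longlongrightarrow> cprod r P xs a b) net"
  using assms
proof (induction xs arbitrary: a b)
  case (Cons x xs)
  show ?case unfolding cprod_simps circ_def
    by (intro tendsto_intros Cons.IH Cons.prems) (use Cons.prems in auto)
qed simp

lemma two_sided_holomorphic:
  assumes "open S" and ab: "a \<le> r" "b \<le> r"
    and hol: "\<And>n a b. a \<le> r \<Longrightarrow> b \<le> r \<Longrightarrow> (\<lambda>z. Q z n a b) holomorphic_on S"
    and decay: "\<And>z0. z0 \<in> S \<Longrightarrow>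
      \<exists>d>0. \<exists>C. \<forall>z\<in>cball z0 d. \<forall>n. mnorm r (Q z n) \<le> C * weight n"
  shows "(\<lambda>z. two_sided r (Q z) a b) holomorphic_on S"
proof (rule holomorphic_uniform_sequence[OF \<open>open S\<close>])
  show "(\<lambda>z. cprod r (Q z) (window N) a b) holomorphic_on S" for N
    by (intro cprod_holomorphic hol ab)
  fix z0 assume "z0 \<in> S"
  with decay obtain d C where d: "d > 0" "\<And>z n. z \<in> cball z0 d \<Longrightarrow> mnorm r (Q z n) \<le> C * weight n"
    by blast
  obtain d' where d': "d' > 0" "cball z0 d' \<subseteq> S"
    using \<open>open S\<close> \<open>z0 \<in> S\<close> open_contains_cball by blast
  have "uniform_limit (cball z0 (min d d')) (\<lambda>N z. cprod r (Q z) (window N) a b)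
          (\<lambda>z. two_sided r (Q z) a b) sequentially"
    using d by (intro uniform_limit_two_sided[where C = C] ab) auto
  then show "\<exists>d>0. cball z0 d \<subseteq> S \<and> uniform_limit (cball z0 d)
      (\<lambda>N z. cprod r (Q z) (window N) a b) (\<lambda>z. two_sided r (Q z) a b) sequentially"
    using d d' by (intro exI[of _ "min d d'"]) auto
qed

section \<open>Sums over one row of the lattice\<close>

definition pole_step :: "(nat \<Rightarrow> nat) \<Rightarrow> (nat \<Rightarrow> complex) \<Rightarrow> int \<Rightarrow> cmat" where
  "pole_step k u = step_matrix (\<lambda>a n. 1 / (u a - of_int n) ^ k a)"

text \<open>
  The entries are the multitangent functions
  \<open>\<Sum>n\<^sub>1 < \<dots> < n\<^sub>l. 1/((u\<^sub>a - n\<^sub>1)\<^bsup>k\<^sub>a\<^esup> \<cdots>)\<close>, the ordered sums over a single row.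
\<close>

definition multitangent :: "nat \<Rightarrow> (nat \<Rightarrow> nat) \<Rightarrow> (nat \<Rightarrow> complex) \<Rightarrow> cmat" where
  "multitangent r k u = two_sided r (pole_step k u)"

lemma mnorm_step_matrix: "mnorm r (step_matrix f x) = (\<Sum>a<r. norm (f a x))"
proof -
  have "mnorm r (step_matrix f x) = (\<Sum>a\<le>r. \<Sum>b\<le>r. if b = Suc a then norm (f a x) else 0)"
    unfolding mnorm_def step_matrix_def by (intro sum.cong) auto
  also have "\<dots> = (\<Sum>a\<le>r. if a < r then norm (f a x) else 0)"
    by (intro sum.cong) auto
  also have "\<dots> = (\<Sum>a<r. norm (f a x))"
    by (rule sum.mono_neutral_cong_right) auto
  finally show ?thesis .
qed

text \<open>
  The constant depends only on a bound for \<open>u\<close> and on the distance to the points of the row. The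
  distance is required for the single integer \<open>n\<close> alone, so that the estimate remains available
  next to a pole for all other integers.
\<close>

lemma pole_step_decay:
  assumes k: "\<And>a. a < r \<Longrightarrow> 2 \<le> k a" and "0 < \<delta>" "0 \<le> R"
  obtains C where "0 \<le> C"
    "\<And>(u :: nat \<Rightarrow> complex) n. (\<And>a. a < r \<Longrightarrow> norm (u a) \<le> R) \<Longrightarrow> (\<And>a. a < r \<Longrightarrow> \<delta> \<le> norm (u a - of_int n)) \<Longrightarrow>
       mnorm r (pole_step k u n) \<le> C * weight n"
proof
  \<comment> \<open>\<open>c (1 + |n|)\<close> bounds the distance from below: by \<open>|n| - R\<close> for large \<open>n\<close>, by \<open>\<delta>\<close> otherwise.\<close>
  define c where "c = min (1 / 2) (\<delta> / (2 * R + 2))"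
  have c: "0 < c" using assms by (auto simp: c_def)
  show "0 \<le> (\<Sum>a<r. 1 / c ^ k a)"
    using c by (intro sum_nonneg) auto
  fix u :: "nat \<Rightarrow> complex" and n :: int
  assume u: "\<And>a. a < r \<Longrightarrow> norm (u a) \<le> R"
    and d: "\<And>a. a < r \<Longrightarrow> \<delta> \<le> norm (u a - of_int n)"
  define w where "w = 1 + real_of_int \<bar>n\<bar>"
  have "norm (1 / (u a - of_int n) ^ k a) \<le> 1 / c ^ k a * weight n" if a: "a < r" for a
  proof -
    have "c * w \<le> norm (u a - of_int n)"
    proof (cases "2 * R + 1 \<le> real_of_int \<bar>n\<bar>")
      case True
      have "c * w \<le> 1 / 2 * w"
        unfolding c_def w_def by (intro mult_right_mono min.cobounded1) auto
      also have "\<dots> \<le> real_of_int \<bar>n\<bar> - R" using True by (simp add: w_def)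
      also have "\<dots> \<le> norm (u a - of_int n)"
        using norm_triangle_ineq2[of "of_int n" "u a"] u[OF a] by (simp add: norm_minus_commute)
      finally show ?thesis .
    next
      case False
      have "c * w \<le> \<delta> / (2 * R + 2) * (2 * R + 2)"
        using False assms unfolding c_def w_def by (intro mult_mono) auto
      also have "\<dots> = \<delta>" using assms by simp
      also note d[OF a]
      finally show ?thesis .
    qed
    then have "(c * w) ^ k a \<le> norm (u a - of_int n) ^ k a"
      using c by (intro power_mono) (auto simp: w_def)
    moreover have "w\<^sup>2 \<le> w ^ k a"
      using k[OF a] by (intro power_increasing) (auto simp: w_def)
    then have "c ^ k a * w\<^sup>2 \<le> (c * w) ^ k a"
      using c unfolding power_mult_distrib by (intro mult_left_mono) auto
    ultimately have "c ^ k a * w\<^sup>2 \<le> norm (u a - of_int n) ^ k a"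
      by linarith
    moreover have "0 < c ^ k a * w\<^sup>2" using c by (auto simp: w_def add_pos_nonneg)
    ultimately have "1 / norm (u a - of_int n) ^ k a \<le> 1 / (c ^ k a * w\<^sup>2)"
      by (intro divide_left_mono) (auto intro!: mult_pos_pos)
    then show ?thesis by (simp add: norm_divide norm_power weight_def w_def)
  qed
  then show "mnorm r (pole_step k u n) \<le> (\<Sum>a<r. 1 / c ^ k a) * weight n"
    unfolding pole_step_def mnorm_step_matrix sum_distrib_right by (intro sum_mono) auto
qed

text \<open>
  Comparison with the telescoping \<open>2/(y + j - 1) - 2/(y + j)\<close>.
\<close>

lemma sum_inverse_square_shifted_le:
  fixes y :: real
  assumes "2 \<le> y" "finite J"
  shows "(\<Sum>j\<in>J. 2 / (y + real j)\<^sup>2) \<le> 4 / y"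
proof -
  obtain m where J: "J \<subseteq> {..<m}"
    using assms finite_nat_iff_bounded by auto
  have "(\<Sum>j<m. 2 / (y + real j)\<^sup>2) \<le> 2 / (y - 1) - 2 / (y + real m - 1)"
  proof (induction m)
    case (Suc m)
    have "2 / (y + real m)\<^sup>2 \<le> 2 / ((y + real m - 1) * (y + real m))"
      unfolding power2_eq_square using assms by (intro divide_left_mono mult_right_mono) auto
    also have "\<dots> = 2 / (y + real m - 1) - 2 / (y + real m)"
      using assms by (simp add: diff_frac_eq)
    finally show ?case using Suc by simp
  qed simp
  also have "\<dots> \<le> 2 / (y - 1)" using assms by simp
  also have "\<dots> \<le> 4 / y" using assms by (simp add: field_simps)
  finally have "(\<Sum>j<m. 2 / (y + real j)\<^sup>2) \<le> 4 / y" .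
  moreover have "(\<Sum>j\<in>J. 2 / (y + real j)\<^sup>2) \<le> (\<Sum>j<m. 2 / (y + real j)\<^sup>2)"
    using J by (intro sum_mono2) auto
  ultimately show ?thesis by linarith
qed

text \<open>
  Integers at most \<open>\<lfloor>Re u\<rfloor>\<close> and integers above it are enumerated outwards, so that the \<open>j\<close>-th one on
  either side has horizontal distance at least \<open>j\<close> from \<open>u\<close>. Together with
  \<open>(y + j)\<^sup>2 \<le> 2 (y\<^sup>2 + j\<^sup>2)\<close> each half is at most \<open>4/y\<close>.
\<close>

lemma sum_inverse_square_le:
  assumes y: "2 \<le> y" "y \<le> \<bar>Im u\<bar>" and "finite S"
  shows "(\<Sum>n\<in>S. 1 / (norm (u - of_int n))\<^sup>2) \<le> 8 / y"
proof -
  define n0 where "n0 = \<lfloor>Re u\<rfloor>"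
  define g where "g j = 2 / (y + real j)\<^sup>2" for j
  have term_le: "1 / (norm (u - of_int n))\<^sup>2 \<le> g j" if "real j \<le> \<bar>Re u - of_int n\<bar>" for n j
  proof -
    have "(y + real j)\<^sup>2 \<le> 2 * (y\<^sup>2 + (real j)\<^sup>2)"
      using sum_squares_ge_zero[of "y - real j" 0] by (simp add: power2_eq_square algebra_simps)
    also have "\<dots> \<le> 2 * ((Im u)\<^sup>2 + (Re u - of_int n)\<^sup>2)"
      using power_mono[OF y(2), of 2] power_mono[OF that, of 2] y by simp
    also have "\<dots> = 2 * (norm (u - of_int n))\<^sup>2" by (simp add: cmod_power2)
    finally have "(y + real j)\<^sup>2 / 2 \<le> (norm (u - of_int n))\<^sup>2" by simp
    moreover have "0 < (y + real j)\<^sup>2 / 2"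
      using y by simp
    ultimately have "1 / (norm (u - of_int n))\<^sup>2 \<le> 1 / ((y + real j)\<^sup>2 / 2)"
      by (intro frac_le) auto
    then show ?thesis by (simp add: g_def)
  qed
  have half: "(\<Sum>n\<in>A. 1 / (norm (u - of_int n))\<^sup>2) \<le> 4 / y"
    if "finite A" "inj_on h A" "\<And>n. n \<in> A \<Longrightarrow> real (h n) \<le> \<bar>Re u - of_int n\<bar>" for A and h :: "int \<Rightarrow> nat"
  proof -
    have "(\<Sum>n\<in>A. 1 / (norm (u - of_int n))\<^sup>2) \<le> (\<Sum>n\<in>A. g (h n))"
      by (intro sum_mono term_le that)
    also have "\<dots> = (\<Sum>j\<in>h ` A. g j)" using that by (simp add: sum.reindex)
    also have "\<dots> \<le> 4 / y"
      unfolding g_def by (rule sum_inverse_square_shifted_le) (use y that in auto)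
    finally show ?thesis .
  qed
  have "(\<Sum>n\<in>{n\<in>S. n \<le> n0}. 1 / (norm (u - of_int n))\<^sup>2) \<le> 4 / y"
    by (rule half[of _ "\<lambda>n. nat (n0 - n)"])
       (use \<open>finite S\<close> in \<open>auto simp: inj_on_def n0_def, linarith\<close>)
  moreover have "(\<Sum>n\<in>{n\<in>S. n > n0}. 1 / (norm (u - of_int n))\<^sup>2) \<le> 4 / y"
    by (rule half[of _ "\<lambda>n. nat (n - n0 - 1)"])
       (use \<open>finite S\<close> in \<open>auto simp: inj_on_def n0_def, linarith\<close>)
  moreover have "S = {n\<in>S. n \<le> n0} \<union> {n\<in>S. n > n0}" by auto
  then have "(\<Sum>n\<in>S. 1 / (norm (u - of_int n))\<^sup>2) = (\<Sum>n\<in>{n\<in>S. n \<le> n0}. 1 / (norm (u - of_int n))\<^sup>2)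
      + (\<Sum>n\<in>{n\<in>S. n > n0}. 1 / (norm (u - of_int n))\<^sup>2)"
    using \<open>finite S\<close> by (subst sum.union_disjoint[symmetric]) auto
  ultimately show ?thesis by simp
qed

lemma norm_inverse_power_le:
  assumes "1 \<le> y" "y \<le> \<bar>Im u\<bar>" "2 \<le> k"
  shows "norm (1 / (u - of_int n) ^ k) \<le> 1 / (norm (u - of_int n))\<^sup>2"
proof -
  have y: "1 \<le> norm (u - of_int n)"
    using abs_Im_le_cmod[of "u - of_int n"] assms by simp
  then have "(norm (u - of_int n))\<^sup>2 \<le> norm (u - of_int n) ^ k"
    using assms by (intro power_increasing) auto
  moreover have "0 < norm (u - of_int n)" using y by linarith
  then have "0 < norm (u - of_int n) ^ k * (norm (u - of_int n))\<^sup>2"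
    by (intro mult_pos_pos zero_less_power)
  ultimately have "1 / norm (u - of_int n) ^ k \<le> 1 / (norm (u - of_int n))\<^sup>2"
    by (intro divide_left_mono) auto
  then show ?thesis by (simp add: norm_divide norm_power)
qed

text \<open>
  The end terms left over when \<open>1/(u-n-1) - 1/(u-n)\<close> is summed over a window.
\<close>

definition boundary_term :: "nat \<Rightarrow> complex \<Rightarrow> real" where
  "boundary_term N u = norm (1 / (u - of_int (int N))) + norm (1 / (u - of_int (1 - int N)))"

lemma boundary_term_tendsto_0: "(\<lambda>N. boundary_term N u) \<longlonglongrightarrow> 0"
proof -
  have "filterlim (\<lambda>N. norm (u - of_int (f N))) at_top sequentially"
    if "\<And>N. \<bar>real_of_int (f N)\<bar> \<ge> real N - 1" for f :: "nat \<Rightarrow> int"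
  proof (rule filterlim_at_top_mono)
    show "filterlim (\<lambda>N. real N - (1 + norm u)) at_top sequentially"
      by real_asymp
    have "real N - (1 + norm u) \<le> norm (u - of_int (f N))" for N
      using that[of N] norm_triangle_ineq2[of "of_int (f N)" u] by (simp add: norm_minus_commute)
    then show "\<forall>\<^sub>F N in sequentially. real N - (1 + norm u) \<le> norm (u - of_int (f N))"
      by simp
  qed
  then have "(\<lambda>N. inverse (norm (u - of_int (f N)))) \<longlonglongrightarrow> 0"
    if "\<And>N. \<bar>real_of_int (f N)\<bar> \<ge> real N - 1" for f :: "nat \<Rightarrow> int"
    using tendsto_inverse_0_at_top that by blast
  from tendsto_add[OF this[of int] this[of "\<lambda>N. 1 - int N"]] show ?thesis
    by (auto simp: boundary_term_def norm_divide inverse_eq_divide)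
qed

text \<open>
  For \<open>k \<ge> 3\<close> one factor \<open>1/|u-n|\<close> is estimated by \<open>1/y\<close>. For \<open>k = 2\<close> absolute values only
  give \<open>O(1/y)\<close>, and the gain comes from subtracting a telescoping sum.
\<close>

lemma norm_sum_inverse_power_le:
  assumes y: "2 \<le> y" "y \<le> \<bar>Im u\<bar>" and k: "2 \<le> k"
  shows "norm (\<Sum>n\<in>set (window N). 1 / (u - of_int n) ^ k) \<le> 8 / y\<^sup>2 + boundary_term N u"
proof (cases "k = 2")
  case True
  let ?W = "set (window N)"
  have ny: "y \<le> norm (u - of_int n)" for n
    using abs_Im_le_cmod[of "u - of_int n"] y by simp
  have nz: "u - of_int n \<noteq> 0" for n using ny[of n] y by auto
  \<comment> \<open>\<open>f (n + 1) - f n = 1 / ((u - n) (u - n - 1))\<close> is the telescoping approximation of \<open>1 / (u - n)\<^sup>2\<close>.\<close>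
  define f where "f n = 1 / (u - of_int n)" for n
  have telescope: "(\<Sum>n\<in>{- int m..int m}. f (n + 1) - f n) = f (int m + 1) - f (- int m)" for m
  proof (induction m)
    case (Suc m)
    have eq: "{- int (Suc m)..int (Suc m)} = insert (- int (Suc m)) (insert (int (Suc m)) {- int m..int m})"
      by auto
    show ?case unfolding eq using Suc by (simp add: add_ac)
  qed simp
  have tel: "norm (\<Sum>n\<in>?W. f (n + 1) - f n) \<le> boundary_term N u"
  proof (cases N)
    case (Suc m)
    then have "(\<Sum>n\<in>?W. f (n + 1) - f n) = f (int N) - f (1 - int N)"
      using telescope[of m] by (simp add: add_ac)
    then show ?thesis using norm_triangle_ineq4 by (simp add: boundary_term_def f_def)
  qed (simp add: boundary_term_def)
  have partial_fractions: "1 / v\<^sup>2 = (1 / (v - 1) - 1 / v) - 1 / (v\<^sup>2 * (v - 1))"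
    if "v \<noteq> 0" "v - 1 \<noteq> 0" for v :: complex
    using that by (simp add: divide_simps) (simp add: algebra_simps power2_eq_square)
  have "1 / (u - of_int n) ^ k = (f (n + 1) - f n) - 1 / ((u - of_int n)\<^sup>2 * (u - of_int (n + 1)))" for n
    using partial_fractions[of "u - of_int n"] nz[of n] nz[of "n + 1"] True
    by (simp add: f_def diff_diff_eq)
  then have "norm (\<Sum>n\<in>?W. 1 / (u - of_int n) ^ k) \<le>
      norm (\<Sum>n\<in>?W. f (n + 1) - f n) + norm (\<Sum>n\<in>?W. 1 / ((u - of_int n)\<^sup>2 * (u - of_int (n + 1))))"
    by (simp only: sum_subtractf[of "\<lambda>n. f (n + 1) - f n"] norm_triangle_ineq4)
  also have "norm (\<Sum>n\<in>?W. 1 / ((u - of_int n)\<^sup>2 * (u - of_int (n + 1)))) \<le>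
      (\<Sum>n\<in>?W. 1 / y * (1 / (norm (u - of_int n))\<^sup>2))"
  proof (rule sum_norm_le)
    fix n
    have "1 / norm (u - of_int (n + 1)) \<le> 1 / y"
      using ny[of "n + 1"] y by (intro frac_le) auto
    then have "1 / norm (u - of_int (n + 1)) * (1 / (norm (u - of_int n))\<^sup>2)
          \<le> 1 / y * (1 / (norm (u - of_int n))\<^sup>2)"
      by (intro mult_right_mono) auto
    then show "norm (1 / ((u - of_int n)\<^sup>2 * (u - of_int (n + 1)))) \<le> 1 / y * (1 / (norm (u - of_int n))\<^sup>2)"
      by (simp add: norm_divide norm_mult norm_power mult.commute)
  qed
  also have "\<dots> = 1 / y * (\<Sum>n\<in>?W. 1 / (norm (u - of_int n))\<^sup>2)"
    by (rule sum_distrib_left[symmetric])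
  also have "\<dots> \<le> 1 / y * (8 / y)"
    using y by (intro mult_left_mono sum_inverse_square_le) auto
  also have "\<dots> = 8 / y\<^sup>2" by (simp add: power2_eq_square)
  finally show ?thesis using tel by simp
next
  case False
  have "norm (\<Sum>n\<in>set (window N). 1 / (u - of_int n) ^ k)
      \<le> (\<Sum>n\<in>set (window N). 1 / y * (1 / (norm (u - of_int n))\<^sup>2))"
  proof (rule sum_norm_le)
    fix n
    have ny: "y \<le> norm (u - of_int n)"
      using abs_Im_le_cmod[of "u - of_int n"] y by simp
    then have "1 / norm (u - of_int n) \<le> 1 / y"
      using y by (intro frac_le) auto
    moreover have "norm (1 / (u - of_int n) ^ (k - 1)) \<le> 1 / (norm (u - of_int n))\<^sup>2"
      using y False k by (intro norm_inverse_power_le[of y]) auto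
    ultimately have "1 / norm (u - of_int n) * norm (1 / (u - of_int n) ^ (k - 1))
       \<le> 1 / y * (1 / (norm (u - of_int n))\<^sup>2)"
      using y by (intro mult_mono) auto
    moreover have "(u - of_int n) ^ k = (u - of_int n) * (u - of_int n) ^ (k - 1)"
      using k by (simp flip: power_Suc)
    ultimately show "norm (1 / (u - of_int n) ^ k) \<le> 1 / y * (1 / (norm (u - of_int n))\<^sup>2)"
      by (simp add: norm_divide norm_mult)
  qed
  also have "\<dots> = 1 / y * (\<Sum>n\<in>set (window N). 1 / (norm (u - of_int n))\<^sup>2)"
    by (rule sum_distrib_left[symmetric])
  also have "\<dots> \<le> 1 / y * (8 / y)"
    using y by (intro mult_left_mono sum_inverse_square_le) auto
  also have "\<dots> = 8 / y\<^sup>2" by (simp add: power2_eq_square)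
  also have "\<dots> \<le> 8 / y\<^sup>2 + boundary_term N u" by (simp add: boundary_term_def)
  finally show ?thesis .
qed

text \<open>
  The quadratic decay away from the real axis that makes the product over all rows converge. The
  linear part of the row product is handled by cancellation, the remainder by
  \<open>exp s - 1 - s \<le> s\<^sup>2\<close> with \<open>s = O(1/y)\<close>. The boundary terms of a finite
  window are not uniformly of order \<open>1/y\<^sup>2\<close> but disappear in the limit of large windows.
\<close>

lemma mnorm_multitangent_far_le:
  assumes k: "\<And>a. a < r \<Longrightarrow> 2 \<le> k a" and Im: "\<And>a. a < r \<Longrightarrow> y \<le> \<bar>Im (u a)\<bar>"
    and y: "2 \<le> y" "8 * real r \<le> y"
  shows "mnorm r (multitangent r k u) \<le> (8 * real r + 64 * (real r)\<^sup>2) / y\<^sup>2"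
proof (rule LIMSEQ_le)
  have dist: "2 \<le> norm (u a - of_int n)" if "a < r" for a n
    using abs_Im_le_cmod[of "u a - of_int n"] Im[OF that] y by simp
  have bounded: "norm (u a) \<le> (\<Sum>a<r. norm (u a))" if "a < r" for a
    by (rule member_le_sum) (use that in auto)
  obtain C where C: "\<And>v n. (\<And>a. a < r \<Longrightarrow> norm (v a) \<le> (\<Sum>a<r. norm (u a))) \<Longrightarrow>
      (\<And>a. a < r \<Longrightarrow> 2 \<le> norm (v a - of_int n)) \<Longrightarrow> mnorm r (pole_step k v n) \<le> C * weight n"
    by (rule pole_step_decay[of r k 2 "\<Sum>a<r. norm (u a)"]) (use k in \<open>auto intro: sum_nonneg\<close>)
  then have "\<And>n. mnorm r (pole_step k u n) \<le> C * weight n"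
    using dist bounded by blast
  then show "(\<lambda>N. mnorm r (cprod r (pole_step k u) (window N))) \<longlonglongrightarrow> mnorm r (multitangent r k u)"
    unfolding multitangent_def by (intro tendsto_mnorm tendsto_two_sided)
  have "(\<lambda>N. (\<Sum>a<r. 8 / y\<^sup>2 + boundary_term N (u a)) + (8 * real r / y)\<^sup>2)
      \<longlonglongrightarrow> (\<Sum>a<r. 8 / y\<^sup>2 + 0) + (8 * real r / y)\<^sup>2"
    by (intro tendsto_intros boundary_term_tendsto_0)
  then show "(\<lambda>N. (\<Sum>a<r. 8 / y\<^sup>2 + boundary_term N (u a)) + (8 * real r / y)\<^sup>2)
      \<longlonglongrightarrow> (8 * real r + 64 * (real r)\<^sup>2) / y\<^sup>2"
    by (simp add: add_divide_distrib power_divide power_mult_distrib mult.commute)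
  have "mnorm r (cprod r (pole_step k u) (window N))
      \<le> (\<Sum>a<r. 8 / y\<^sup>2 + boundary_term N (u a)) + (8 * real r / y)\<^sup>2" for N
  proof -
    let ?W = "window N"
    let ?Sum = "\<lambda>i j. \<Sum>n\<leftarrow>?W. pole_step k u n i j"
    define b where "b n = mnorm r (pole_step k u n)" for n
    define s where "s = (\<Sum>n\<leftarrow>?W. b n)"
    have s0: "0 \<le> s" unfolding s_def b_def by (intro sum_list_nonneg) auto
    have "s = (\<Sum>n\<in>set ?W. \<Sum>a<r. norm (1 / (u a - of_int n) ^ k a))"
      unfolding s_def b_def pole_step_def mnorm_step_matrix
      by (rule sum_list_distinct_conv_sum_set) simp
    also have "\<dots> = (\<Sum>a<r. \<Sum>n\<in>set ?W. norm (1 / (u a - of_int n) ^ k a))"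
      by (rule sum.swap)
    also have "\<dots> \<le> (\<Sum>a<r. 8 / y)"
    proof (rule sum_mono)
      fix a assume "a \<in> {..<r}"
      then have a: "2 \<le> k a" "y \<le> \<bar>Im (u a)\<bar>" using k Im by auto
      have "(\<Sum>n\<in>set ?W. norm (1 / (u a - of_int n) ^ k a))
          \<le> (\<Sum>n\<in>set ?W. 1 / (norm (u a - of_int n))\<^sup>2)"
        using a y by (intro sum_mono norm_inverse_power_le[of y]) auto
      also have "\<dots> \<le> 8 / y" by (rule sum_inverse_square_le) (use a y in auto)
      finally show "(\<Sum>n\<in>set ?W. norm (1 / (u a - of_int n) ^ k a)) \<le> 8 / y" .
    qed
    finally have s: "s \<le> 8 * real r / y" by (simp add: mult.commute)
    moreover have "8 * real r / y \<le> 1" using y by simp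
    ultimately have "s \<le> 1" by linarith
    then have "exp s - 1 - s \<le> s\<^sup>2" using exp_bound[OF s0] by simp
    also have "\<dots> \<le> (8 * real r / y)\<^sup>2" using s s0 by (intro power_mono)
    finally have exps: "exp s - 1 - s \<le> (8 * real r / y)\<^sup>2" .
    have "mnorm r (\<lambda>i j. cprod r (pole_step k u) ?W i j - ?Sum i j)
        \<le> (\<Prod>n\<leftarrow>?W. 1 + b n) - 1 - (\<Sum>n\<leftarrow>?W. b n)"
      by (rule mnorm_cprod_minus_sum_le) (simp add: b_def)
    also have "\<dots> \<le> exp s - 1 - s"
      using prod_list_one_plus_le_exp[of b ?W] by (simp add: b_def s_def)
    also note exps
    finally have rest: "mnorm r (\<lambda>i j. cprod r (pole_step k u) ?W i j - ?Sum i j) \<le> (8 * real r / y)\<^sup>2" .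
    have "?Sum = step_matrix (\<lambda>a _. \<Sum>n\<in>set ?W. 1 / (u a - of_int n) ^ k a) ()"
      by (intro ext, subst sum_list_distinct_conv_sum_set) (simp_all add: pole_step_def step_matrix_def)
    then have "mnorm r ?Sum = (\<Sum>a<r. norm (\<Sum>n\<in>set ?W. 1 / (u a - of_int n) ^ k a))"
      by (simp only: mnorm_step_matrix)
    also have "\<dots> \<le> (\<Sum>a<r. 8 / y\<^sup>2 + boundary_term N (u a))"
      using k Im y by (intro sum_mono norm_sum_inverse_power_le) auto
    finally have "mnorm r ?Sum \<le> (\<Sum>a<r. 8 / y\<^sup>2 + boundary_term N (u a))" .
    then show ?thesis
      using rest mnorm_add_le[of r "\<lambda>i j. cprod r (pole_step k u) ?W i j - ?Sum i j" ?Sum] by simp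
  qed
  then show "\<exists>N0. \<forall>N\<ge>N0. mnorm r (cprod r (pole_step k u) (window N))
      \<le> (\<Sum>a<r. 8 / y\<^sup>2 + boundary_term N (u a)) + (8 * real r / y)\<^sup>2"
    by blast
qed

section \<open>Decay and periodicity of row sums\<close>

lemma multitangent_near_le:
  assumes k: "\<And>a. a < r \<Longrightarrow> 2 \<le> k a" and "0 < \<delta>" "0 \<le> R"
  obtains B where "0 \<le> B"
    "\<And>u. (\<And>a. a < r \<Longrightarrow> norm (u a) \<le> R) \<Longrightarrow> (\<And>a n. a < r \<Longrightarrow> \<delta> \<le> norm (u a - of_int n)) \<Longrightarrow>
       mnorm r (multitangent r k u) \<le> B"
proof -
  obtain C where C: "0 \<le> C"
    "\<And>(u :: nat \<Rightarrow> complex) n. (\<And>a. a < r \<Longrightarrow> norm (u a) \<le> R) \<Longrightarrow> (\<And>a. a < r \<Longrightarrow> \<delta> \<le> norm (u a - of_int n)) \<Longrightarrow>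
       mnorm r (pole_step k u n) \<le> C * weight n"
    using pole_step_decay[of r k \<delta> R] assms by metis
  show ?thesis
  proof (rule that[of "(1 + C) * exp (3 * C)"])
    fix u :: "nat \<Rightarrow> complex"
    assume u: "\<And>a. a < r \<Longrightarrow> norm (u a) \<le> R" "\<And>a n. a < r \<Longrightarrow> \<delta> \<le> norm (u a - of_int n)"
    have decay: "mnorm r (pole_step k u n) \<le> C * weight n" for n
      using C(2) u by blast
    have "1 + mnorm r (multitangent r k u) \<le> (1 + mnorm r (pole_step k u 0)) * exp (3 * C)"
      unfolding multitangent_def using decay C(1) by (intro mnorm_two_sided_le) auto
    also have "\<dots> \<le> (1 + C) * exp (3 * C)"
      using decay[of 0] by (intro mult_right_mono) auto
    finally show "mnorm r (multitangent r k u) \<le> (1 + C) * exp (3 * C)" by linarith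
  qed (use C in auto)
qed

text \<open>
  For large \<open>|m|\<close> the imaginary part of \<open>z - m\<tau>\<close> is at least a multiple of \<open>1 + |m|\<close>. The finitely
  many remaining rows are merely bounded, as long as \<open>z\<close> keeps a distance from them. The
  distance condition concerns the row \<open>m\<close> alone, so the other rows are controlled even when one
  row comes close to \<open>z\<close>.
\<close>

lemma multitangent_rows_decay:
  assumes k: "\<And>a. a < r \<Longrightarrow> 2 \<le> k a" and "0 < \<delta>" "0 \<le> R" and \<tau>: "0 < Im \<tau>"
  obtains C where "0 \<le> C"
    "\<And>z m. (\<And>a. a < r \<Longrightarrow> norm (z a) \<le> R) \<Longrightarrow>
       (\<And>a n. a < r \<Longrightarrow> \<delta> \<le> norm (z a - of_int m * \<tau> - of_int n)) \<Longrightarrow>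
       mnorm r (multitangent r k (\<lambda>a. z a - of_int m * \<tau>)) \<le> C * weight m"
proof -
  define h where "h = Im \<tau> / 2"
  have h: "0 < h" using \<tau> by (simp add: h_def)
  \<comment> \<open>From row \<open>m0\<close> on, \<open>z - m\<tau>\<close> is far enough from the real axis for the quadratic bound.\<close>
  obtain m0 :: nat where "(R + h + 2 + 8 * real r) / h \<le> real m0"
    using real_arch_simple by blast
  then have m0: "R + h + 2 + 8 * real r \<le> real m0 * h" using h by (simp add: divide_le_eq)
  define R' where "R' = R + real m0 * norm \<tau>"
  obtain B where B: "0 \<le> B"
    "\<And>u. (\<And>a. a < r \<Longrightarrow> norm (u a) \<le> R') \<Longrightarrow> (\<And>a n. a < r \<Longrightarrow> \<delta> \<le> norm (u a - of_int n)) \<Longrightarrow>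
       mnorm r (multitangent r k u) \<le> B"
    using multitangent_near_le[of r k \<delta> R'] assms(1-3) unfolding R'_def
    by (metis add_nonneg_nonneg mult_nonneg_nonneg norm_ge_zero of_nat_0_le_iff)
  define C1 where "C1 = (8 * real r + 64 * (real r)\<^sup>2) / h\<^sup>2"
  define C2 where "C2 = B * (1 + real m0)\<^sup>2"
  have C: "0 \<le> C1" "0 \<le> C2" using B(1) by (auto simp: C1_def C2_def)
  show ?thesis
  proof (rule that[of "C1 + C2"])
    fix z :: "nat \<Rightarrow> complex" and m :: int
    assume z: "\<And>a. a < r \<Longrightarrow> norm (z a) \<le> R"
      and d: "\<And>a n. a < r \<Longrightarrow> \<delta> \<le> norm (z a - of_int m * \<tau> - of_int n)"
    let ?T = "multitangent r k (\<lambda>a. z a - of_int m * \<tau>)"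
    show "mnorm r ?T \<le> (C1 + C2) * weight m"
    proof (cases "int m0 \<le> \<bar>m\<bar>")
      case True
      then have "real m0 * h \<le> real_of_int \<bar>m\<bar> * h" using h by (intro mult_right_mono) linarith+
      with m0 have m: "R + h + 2 + 8 * real r \<le> real_of_int \<bar>m\<bar> * h" by linarith
      define y where "y = h * (1 + real_of_int \<bar>m\<bar>)"
      have "y \<le> \<bar>Im (z a - of_int m * \<tau>)\<bar>" if "a < r" for a
      proof -
        have "\<bar>Im (z a)\<bar> \<le> R" using z[OF that] abs_Im_le_cmod order_trans by blast
        moreover have "\<bar>real_of_int m * Im \<tau>\<bar> = 2 * (real_of_int \<bar>m\<bar> * h)"
          using \<tau> by (simp add: h_def abs_mult)
        ultimately show ?thesis using m unfolding y_def by (simp add: algebra_simps)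
      qed
      then have "mnorm r ?T \<le> (8 * real r + 64 * (real r)\<^sup>2) / y\<^sup>2"
      proof (intro mnorm_multitangent_far_le k)
        have "y = h + real_of_int \<bar>m\<bar> * h" by (simp add: y_def algebra_simps)
        then show "2 \<le> y" "8 * real r \<le> y" using m h assms(3) by linarith+
      qed auto
      also have "\<dots> = C1 * weight m"
        by (simp add: C1_def y_def weight_def power_mult_distrib)
      also have "\<dots> \<le> (C1 + C2) * weight m" using C by (intro mult_right_mono) auto
      finally show ?thesis .
    next
      case False
      have "norm (z a - of_int m * \<tau>) \<le> R'" if "a < r" for a
      proof -
        have "norm (z a - of_int m * \<tau>) \<le> norm (z a) + real_of_int \<bar>m\<bar> * norm \<tau>"
          using norm_triangle_ineq4[of "z a" "of_int m * \<tau>"] by (simp add: norm_mult)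
        also have "\<dots> \<le> R + real m0 * norm \<tau>"
          using False z[OF that] by (intro add_mono mult_right_mono) auto
        finally show ?thesis by (simp add: R'_def)
      qed
      then have "mnorm r ?T \<le> B" using d by (intro B(2)) auto
      also have "B \<le> B * ((1 + real m0)\<^sup>2 * weight m)"
      proof -
        have "(1 + real_of_int \<bar>m\<bar>)\<^sup>2 \<le> (1 + real m0)\<^sup>2"
          using False by (intro power_mono) auto
        then have "1 \<le> (1 + real m0)\<^sup>2 * weight m" by (simp add: weight_def)
        then show ?thesis using mult_left_mono[OF _ B(1)] by fastforce
      qed
      also have "\<dots> = C2 * weight m" by (simp add: C2_def)
      also have "\<dots> \<le> (C1 + C2) * weight m" using C by (intro mult_right_mono) auto
      finally show ?thesis .
    qed
  qed (use C in auto)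
qed

lemma pole_step_decay_pointwise:
  fixes u :: "nat \<Rightarrow> complex"
  assumes k: "\<And>a. a < r \<Longrightarrow> 2 \<le> k a" and u: "\<And>a. a < r \<Longrightarrow> u a \<notin> \<int>"
  obtains C where "\<And>n. mnorm r (pole_step k u n) \<le> C * weight n"
proof -
  have "compact (u ` {..<r})" by (intro finite_imp_compact) auto
  moreover have "closed (\<int> :: complex set)" by simp
  moreover have "u ` {..<r} \<inter> \<int> = {}" using u by auto
  ultimately obtain d where d: "0 < d" "\<And>x n. x \<in> u ` {..<r} \<Longrightarrow> n \<in> \<int> \<Longrightarrow> d \<le> dist x n"
    using separate_compact_closed[of "u ` {..<r}" \<int>] by blast
  have bounded: "norm (u a) \<le> (\<Sum>a<r. norm (u a))" if "a < r" for a
    by (rule member_le_sum) (use that in auto)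
  have dist: "d \<le> norm (u a - of_int n)" if "a < r" for a n
    using d(2)[of "u a" "of_int n"] that by (auto simp: dist_norm)
  obtain C where "\<And>(v :: nat \<Rightarrow> complex) n. (\<And>a. a < r \<Longrightarrow> norm (v a) \<le> (\<Sum>a<r. norm (u a))) \<Longrightarrow>
      (\<And>a. a < r \<Longrightarrow> d \<le> norm (v a - of_int n)) \<Longrightarrow> mnorm r (pole_step k v n) \<le> C * weight n"
    by (rule pole_step_decay[of r k d "\<Sum>a<r. norm (u a)"]) (use k d in \<open>auto intro: sum_nonneg\<close>)
  with bounded dist show ?thesis by (intro that[of C]) blast
qed

lemma multitangent_shift:
  assumes k: "\<And>a. a < r \<Longrightarrow> 2 \<le> k a" and u: "\<And>a. a < r \<Longrightarrow> u a \<notin> \<int>" and ij: "i \<le> r" "j \<le> r"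
  shows "multitangent r k (\<lambda>a. u a + of_int t) i j = multitangent r k u i j"
proof -
  obtain C where "\<And>n. mnorm r (pole_step k u n) \<le> C * weight n"
    using pole_step_decay_pointwise[of r k u] k u by blast
  then have "two_sided r (\<lambda>n. pole_step k u (n - t)) i j = two_sided r (pole_step k u) i j"
    using ij by (rule two_sided_shift)
  moreover have "(\<lambda>n. pole_step k u (n - t)) = pole_step k (\<lambda>a. u a + of_int t)"
    by (simp add: fun_eq_iff pole_step_def step_matrix_def algebra_simps)
  ultimately show ?thesis by (simp add: multitangent_def)
qed

lemma away_from_complement:
  fixes S :: "'a::real_normed_vector set"
  assumes "open S" "z0 \<in> S"
  obtains d where "0 < d" "\<And>z w. z \<in> cball z0 d \<Longrightarrow> w \<notin> S \<Longrightarrow> d \<le> norm (z - w)"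
proof -
  obtain e where e: "0 < e" "ball z0 e \<subseteq> S"
    using assms open_contains_ball by blast
  show ?thesis
  proof (rule that[of "e / 2"])
    fix z w assume zw: "z \<in> cball z0 (e / 2)" "w \<notin> S"
    then have "e \<le> dist z0 w" using e by (meson mem_ball not_le subsetD)
    also have "\<dots> \<le> dist z0 z + dist z w" by (rule dist_triangle)
    finally show "e / 2 \<le> norm (z - w)" using zw by (simp add: dist_norm)
  qed (use e in auto)
qed

lemma multitangent_holomorphic:
  assumes k: "\<And>a. a < r \<Longrightarrow> 2 \<le> k a" and ij: "i \<le> r" "j \<le> r"
  shows "(\<lambda>z. multitangent r k (\<lambda>_. z) i j) holomorphic_on - \<int>"
  unfolding multitangent_def
proof (rule two_sided_holomorphic[OF _ ij])
  show "(\<lambda>z. pole_step k (\<lambda>_. z) n i j) holomorphic_on - \<int>" for n i j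
    by (cases "j = Suc i") (auto simp: pole_step_def step_matrix_def intro!: holomorphic_intros)
  fix z0 :: complex assume "z0 \<in> - \<int>"
  have "open (- \<int> :: complex set)" by auto
  from away_from_complement[OF this \<open>z0 \<in> - \<int>\<close>] obtain d where d: "0 < d" "\<And>z w. z \<in> cball z0 d \<Longrightarrow> w \<notin> - \<int> \<Longrightarrow> d \<le> norm (z - w)"
    by blast
  obtain C where C: "\<And>(u :: nat \<Rightarrow> complex) n. (\<And>a. a < r \<Longrightarrow> norm (u a) \<le> norm z0 + d) \<Longrightarrow>
      (\<And>a. a < r \<Longrightarrow> d \<le> norm (u a - of_int n)) \<Longrightarrow> mnorm r (pole_step k u n) \<le> C * weight n"
    by (rule pole_step_decay[of r k d "norm z0 + d"]) (use k d in auto)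
  have "mnorm r (pole_step k (\<lambda>_. z) n) \<le> C * weight n" if "z \<in> cball z0 d" for z n
  proof (rule C)
    show "norm z \<le> norm z0 + d"
      using that norm_triangle_ineq2[of z z0] by (simp add: dist_norm norm_minus_commute)
    show "d \<le> norm (z - of_int n)" using d(2)[OF that, of "of_int n"] by simp
  qed
  then show "\<exists>d>0. \<exists>C. \<forall>z\<in>cball z0 d. \<forall>n. mnorm r (pole_step k (\<lambda>_. z) n) \<le> C * weight n"
    using d(1) by blast
qed auto

section \<open>The lattice\<close>

lemma lattice_iff: "w \<in> lattice \<tau> \<longleftrightarrow> (\<exists>m n. w = of_int m * \<tau> + of_int n)"
  by (auto simp: lattice_def)

lemma lattice_add: "w \<in> lattice \<tau> \<Longrightarrow> w' \<in> lattice \<tau> \<Longrightarrow> w + w' \<in> lattice \<tau>"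
  unfolding lattice_iff
proof (elim exE)
  fix m n m' n' assume "w = of_int m * \<tau> + of_int n" "w' = of_int m' * \<tau> + of_int n'"
  then have "w + w' = of_int (m + m') * \<tau> + of_int (n + n')" by (simp add: algebra_simps)
  then show "\<exists>m n. w + w' = of_int m * \<tau> + of_int n" by blast
qed

lemma lattice_uminus: "w \<in> lattice \<tau> \<Longrightarrow> - w \<in> lattice \<tau>"
  unfolding lattice_iff
proof (elim exE)
  fix m n assume "w = of_int m * \<tau> + of_int n"
  then have "- w = of_int (- m) * \<tau> + of_int (- n)" by simp
  then show "\<exists>m n. - w = of_int m * \<tau> + of_int n" by blast
qed

lemma lattice_diff: "w \<in> lattice \<tau> \<Longrightarrow> w' \<in> lattice \<tau> \<Longrightarrow> w - w' \<in> lattice \<tau>"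
  using lattice_add[OF _ lattice_uminus] by fastforce

text \<open>
  A disc contains only finitely many lattice points. The gap is needed also at lattice points
  \<open>z\<close>, where it isolates them from the others.
\<close>

lemma lattice_gap:
  assumes \<tau>: "0 < Im \<tau>"
  obtains \<delta> where "0 < \<delta>" "\<And>w. w \<in> lattice \<tau> \<Longrightarrow> w \<noteq> z \<Longrightarrow> \<delta> \<le> norm (z - w)"
proof -
  define R where "R = norm z + 1"
  obtain M :: nat where M: "R / Im \<tau> < real M" using reals_Archimedean2 by blast
  obtain N :: nat where N: "R + real M * norm \<tau> < real N" using reals_Archimedean2 by blast
  have near: "w \<in> lattice_box \<tau> M N" if w: "w \<in> lattice \<tau>" and "norm w \<le> R" for w
  proof -
    obtain m n where w: "w = of_int m * \<tau> + of_int n" using w by (auto simp: lattice_iff)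
    have "real_of_int \<bar>m\<bar> * Im \<tau> = \<bar>Im w\<bar>" using \<tau> by (simp add: w abs_mult)
    also have "\<dots> \<le> R" using abs_Im_le_cmod[of w] that by simp
    also have "\<dots> < real M * Im \<tau>" using M \<tau> by (simp add: divide_less_eq)
    finally have m: "real_of_int \<bar>m\<bar> < real M" using \<tau> by simp
    have "real_of_int \<bar>n\<bar> = norm (w - of_int m * \<tau>)" by (simp add: w)
    also have "\<dots> \<le> norm w + real_of_int \<bar>m\<bar> * norm \<tau>"
      using norm_triangle_ineq4[of w "of_int m * \<tau>"] by (simp add: norm_mult)
    also have "\<dots> \<le> R + real M * norm \<tau>" using m that by (intro add_mono mult_right_mono) auto
    also note N
    finally have "\<bar>n\<bar> < int N" by linarith
    moreover have "\<bar>m\<bar> < int M" using m by linarith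
    ultimately show ?thesis using w by (auto simp: lattice_box_def)
  qed
  obtain d where d: "0 < d" "\<And>w. w \<in> lattice_box \<tau> M N \<Longrightarrow> w \<noteq> z \<Longrightarrow> d \<le> dist z w"
    using finite_set_avoid[OF finite_lattice_box[of \<tau> M N], of z] by blast
  show ?thesis
  proof (rule that[of "min d 1"])
    fix w assume w: "w \<in> lattice \<tau>" "w \<noteq> z"
    show "min d 1 \<le> norm (z - w)"
    proof (cases "norm w \<le> R")
      case True
      then show ?thesis using d(2)[OF near[OF w(1)] w(2)] by (simp add: dist_norm min.coboundedI1)
    next
      case False
      then show ?thesis
        using norm_triangle_ineq2[of w z] by (simp add: R_def norm_minus_commute)
    qed
  qed (use d in auto)
qed

lemma closed_lattice:
  assumes \<tau>: "0 < Im \<tau>"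
  shows "closed (lattice \<tau>)"
proof -
  obtain \<delta> where \<delta>: "0 < \<delta>" "\<And>w. w \<in> lattice \<tau> \<Longrightarrow> w \<noteq> 0 \<Longrightarrow> \<delta> \<le> norm (0 - w)"
    using lattice_gap[OF \<tau>] by blast
  show ?thesis
  proof (rule discrete_imp_closed[OF \<delta>(1)], intro ballI impI)
    fix x y assume "x \<in> lattice \<tau>" "y \<in> lattice \<tau>" "dist y x < \<delta>"
    then show "y = x" using \<delta>(2)[OF lattice_diff[of y \<tau> x]] by (auto simp: dist_norm norm_minus_commute)
  qed
qed

lemma sorted_wrt_concat_map:
  assumes "sorted_wrt L ms" "\<And>m. m \<in> set ms \<Longrightarrow> sorted_wrt R (g m)"
    and "\<And>m m' x y. L m m' \<Longrightarrow> x \<in> set (g m) \<Longrightarrow> y \<in> set (g m') \<Longrightarrow> R x y"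
  shows "sorted_wrt R (concat (map g ms))"
  using assms(1,2) by (induction ms) (auto simp: sorted_wrt_append intro: assms(3))

text \<open>
  Listing a box of lattice points in increasing order means listing it row by row.
\<close>

lemma truncated_sum_eq_cprod:
  assumes \<tau>: "0 < Im \<tau>" and "0 < r"
  shows "(\<Sum>ws\<in>lattice_chains \<tau> M N r. \<Prod>i<r. 1 / (z i - ws ! i) ^ k i) =
    cprod r (\<lambda>m. cprod r (pole_step k (\<lambda>a. z a - of_int m * \<tau>)) (window N)) (window M) 0 r"
proof -
  define point :: "int \<Rightarrow> int \<Rightarrow> complex" where "point m n = of_int m * \<tau> + of_int n" for m n
  define xs where "xs = concat (map (\<lambda>m. map (point m) (window N)) (window M))"
  define f where "f a w = 1 / (z a - w) ^ k a" for a w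
  have set_xs: "set xs = lattice_box \<tau> M N"
    by (force simp: xs_def lattice_box_def point_def)
  have less_iff: "lattice_less \<tau> (point m n) (point m' n') \<longleftrightarrow> m < m' \<or> m = m' \<and> n < n'" for m n m' n'
    unfolding point_def by (rule lattice_less_iff[OF \<tau>])
  have sorted_window: "sorted_wrt (<) (window K)" for K
    by (simp add: window_def)
  have "sorted_wrt (lattice_less \<tau>) xs"
    unfolding xs_def using sorted_window[of N] sorted_window[of M]
    by (intro sorted_wrt_concat_map[where L = "(<)"]) (auto simp: sorted_wrt_map less_iff)
  moreover have "\<not> lattice_less \<tau> w' w" if "lattice_less \<tau> w w'" for w w'
    using that lattice_coords_unique[OF \<tau>] unfolding lattice_less_def
    by (metis less_asym less_irrefl)
  ultimately have "(\<Sum>ws\<in>ordered_tuples (lattice_less \<tau>) (set xs) r. \<Prod>i<r. f (0 + i) (ws ! i))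
      = cprod r (step_matrix f) xs 0 (0 + r)"
    using \<open>0 < r\<close> by (intro chain_sum_eq_cprod) auto
  also have "cprod r (step_matrix f) xs =
      cprod r (\<lambda>m. cprod r (\<lambda>n. step_matrix f (point m n)) (window N)) (window M)"
    unfolding xs_def cprod_concat cprod_map ..
  also have "(\<lambda>m n. step_matrix f (point m n)) = (\<lambda>m. pole_step k (\<lambda>a. z a - of_int m * \<tau>))"
    by (simp add: fun_eq_iff step_matrix_def pole_step_def f_def point_def diff_diff_eq)
  finally show ?thesis
    by (simp add: set_xs f_def ordered_tuples_def lattice_chains_def)
qed

section \<open>The elliptic function\<close>

definition wp_rows :: "nat \<Rightarrow> (nat \<Rightarrow> nat) \<Rightarrow> complex \<Rightarrow> (nat \<Rightarrow> complex) \<Rightarrow> int \<Rightarrow> cmat" where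
  "wp_rows r k \<tau> z m = multitangent r k (\<lambda>a. z a - of_int m * \<tau>)"

text \<open>
  The ordered product over all lattice points. The depth-\<open>r\<close> function is its corner entry
  \<open>(0, r)\<close>; the other entries are the functions belonging to contiguous parts of \<open>k\<close>.
\<close>

definition wp_matrix :: "nat \<Rightarrow> (nat \<Rightarrow> nat) \<Rightarrow> complex \<Rightarrow> (nat \<Rightarrow> complex) \<Rightarrow> cmat" where
  "wp_matrix r k \<tau> z = two_sided r (wp_rows r k \<tau> z)"

lemma row_not_Ints:
  assumes "z \<notin> lattice \<tau>"
  shows "z - of_int m * \<tau> \<notin> \<int>"
proof
  assume "z - of_int m * \<tau> \<in> \<int>"
  then obtain n where "z - of_int m * \<tau> = of_int n" by (auto elim: Ints_cases)
  then have "z = of_int m * \<tau> + of_int n" by (simp add: algebra_simps)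
  then show False using assms lattice_iff by blast
qed

lemma wp_rows_decay_pointwise:
  fixes z :: "nat \<Rightarrow> complex"
  assumes k: "\<And>a. a < r \<Longrightarrow> 2 \<le> k a" and \<tau>: "0 < Im \<tau>" and z: "\<And>a. a < r \<Longrightarrow> z a \<notin> lattice \<tau>"
  obtains C where "\<And>m. mnorm r (wp_rows r k \<tau> z m) \<le> C * weight m"
proof -
  have "compact (z ` {..<r})" by (intro finite_imp_compact) auto
  moreover have "z ` {..<r} \<inter> lattice \<tau> = {}" using z by auto
  ultimately obtain d where
    d: "0 < d" "\<And>x w. x \<in> z ` {..<r} \<Longrightarrow> w \<in> lattice \<tau> \<Longrightarrow> d \<le> dist x w"
    using separate_compact_closed[of "z ` {..<r}" "lattice \<tau>"] closed_lattice[OF \<tau>] by blast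
  have bounded: "norm (z a) \<le> (\<Sum>a<r. norm (z a))" if "a < r" for a
    by (rule member_le_sum) (use that in auto)
  have dist: "d \<le> norm (z a - of_int m * \<tau> - of_int n)" if "a < r" for a m n
    using d(2)[of "z a" "of_int m * \<tau> + of_int n"] that by (auto simp: dist_norm lattice_iff diff_diff_eq)
  obtain C where C: "\<And>v m. (\<And>a. a < r \<Longrightarrow> norm (v a) \<le> (\<Sum>a<r. norm (z a))) \<Longrightarrow>
      (\<And>a n. a < r \<Longrightarrow> d \<le> norm (v a - of_int m * \<tau> - of_int n)) \<Longrightarrow>
      mnorm r (multitangent r k (\<lambda>a. v a - of_int m * \<tau>)) \<le> C * weight m"
    by (rule multitangent_rows_decay[of r k d "\<Sum>a<r. norm (z a)" \<tau>])
       (use k d \<tau> in \<open>auto intro: sum_nonneg\<close>)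
  have "mnorm r (wp_rows r k \<tau> z m) \<le> C * weight m" for m
    unfolding wp_rows_def by (rule C[OF bounded dist])
  then show ?thesis by (rule that)
qed

text \<open>
  Both iterated limits genuinely exist away from the lattice, so \<open>lim\<close> picks out their values:
  for fixed \<open>M\<close> the finitely many rows converge separately, and the completed rows decay fast
  enough for their product to converge.
\<close>

lemma multi_wp_eq_wp_matrix:
  assumes \<tau>: "0 < Im \<tau>" and ks: "ks \<noteq> []" "\<forall>k\<in>set ks. 2 \<le> k"
    and zs: "length zs = length ks" "set zs \<inter> lattice \<tau> = {}"
  shows "multi_wp \<tau> ks zs = wp_matrix (length ks) ((!) ks) \<tau> ((!) zs) 0 (length ks)"
proof -
  define r where "r = length ks"
  define k where "k = (!) ks"
  define z where "z = (!) zs"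
  have r: "0 < r" using ks by (simp add: r_def)
  have k: "2 \<le> k a" if "a < r" for a using that ks by (simp add: r_def k_def)
  have z: "z a \<notin> lattice \<tau>" if "a < r" for a
    using that zs nth_mem[of a zs] unfolding r_def z_def by (metis IntI empty_iff)
  have inner: "(\<lambda>N. \<Sum>ws\<in>lattice_chains \<tau> M N r. \<Prod>i<r. 1 / (z i - ws ! i) ^ k i)
       \<longlonglongrightarrow> cprod r (wp_rows r k \<tau> z) (window M) 0 r" for M
    unfolding truncated_sum_eq_cprod[OF \<tau> r]
  proof (rule tendsto_cprod)
    fix m a b assume ab: "a \<le> r" "b \<le> r"
    obtain C where "\<And>n. mnorm r (pole_step k (\<lambda>a. z a - of_int m * \<tau>) n) \<le> C * weight n"
      using pole_step_decay_pointwise[of r k "\<lambda>a. z a - of_int m * \<tau>"] k row_not_Ints[OF z] by blast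
    then show "(\<lambda>N. cprod r (pole_step k (\<lambda>a. z a - of_int m * \<tau>)) (window N) a b)
        \<longlonglongrightarrow> wp_rows r k \<tau> z m a b"
      unfolding wp_rows_def multitangent_def using ab by (rule tendsto_two_sided)
  qed auto
  obtain C where "\<And>m. mnorm r (wp_rows r k \<tau> z m) \<le> C * weight m"
    using wp_rows_decay_pointwise[of r k \<tau> z] k z \<tau> by blast
  then have "(\<lambda>M. cprod r (wp_rows r k \<tau> z) (window M) 0 r) \<longlonglongrightarrow> wp_matrix r k \<tau> z 0 r"
    unfolding wp_matrix_def by (rule tendsto_two_sided) auto
  then have outer: "lim (\<lambda>M. cprod r (wp_rows r k \<tau> z) (window M) 0 r) = wp_matrix r k \<tau> z 0 r"
    by (rule limI)
  show ?thesis
    unfolding multi_wp_def r_def[symmetric] k_def[symmetric] z_def[symmetric] limI[OF inner] outer ..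
qed

lemma wp_matrix_cong:
  assumes eq: "\<And>a. a < r \<Longrightarrow> z a = z' a" and ij: "i \<le> r" "j \<le> r"
  shows "wp_matrix r k \<tau> z i j = wp_matrix r k \<tau> z' i j"
  unfolding wp_matrix_def
proof (rule two_sided_cong[OF _ ij])
  fix m a b assume ab: "a \<le> r" "b \<le> r"
  show "wp_rows r k \<tau> z m a b = wp_rows r k \<tau> z' m a b"
    unfolding wp_rows_def multitangent_def
    by (rule two_sided_cong[OF _ ab]) (simp add: pole_step_def step_matrix_def eq)
qed

text \<open>
  Translation by \<open>s\<tau> + t\<close> turns row \<open>m\<close> into row \<open>m - s\<close> translated by the integer \<open>t\<close>, which
  the completed row does not notice.
\<close>

lemma wp_matrix_shift:
  assumes k: "\<And>a. a < r \<Longrightarrow> 2 \<le> k a" and \<tau>: "0 < Im \<tau>" and z: "\<And>a. a < r \<Longrightarrow> z a \<notin> lattice \<tau>"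
    and \<omega>: "\<omega> \<in> lattice \<tau>" and ij: "i \<le> r" "j \<le> r"
  shows "wp_matrix r k \<tau> (\<lambda>a. z a + \<omega>) i j = wp_matrix r k \<tau> z i j"
proof -
  obtain s t where st: "\<omega> = of_int s * \<tau> + of_int t" using \<omega> by (auto simp: lattice_iff)
  have rows: "wp_rows r k \<tau> (\<lambda>a. z a + \<omega>) m a b = wp_rows r k \<tau> z (m - s) a b"
    if "a \<le> r" "b \<le> r" for m a b
  proof -
    have "(\<lambda>a. z a + \<omega> - of_int m * \<tau>) = (\<lambda>a. z a - of_int (m - s) * \<tau> + of_int t)"
      by (simp add: st algebra_simps)
    moreover have "multitangent r k (\<lambda>a. z a - of_int (m - s) * \<tau> + of_int t) a b
        = multitangent r k (\<lambda>a. z a - of_int (m - s) * \<tau>) a b"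
      by (intro multitangent_shift k row_not_Ints z that)
    ultimately show ?thesis by (simp only: wp_rows_def)
  qed
  have "wp_matrix r k \<tau> (\<lambda>a. z a + \<omega>) i j = two_sided r (\<lambda>m. wp_rows r k \<tau> z (m - s)) i j"
    unfolding wp_matrix_def using ij by (intro two_sided_cong rows)
  also obtain C where "\<And>m. mnorm r (wp_rows r k \<tau> z m) \<le> C * weight m"
    using wp_rows_decay_pointwise[of r k \<tau> z] k z \<tau> by blast
  then have "two_sided r (\<lambda>m. wp_rows r k \<tau> z (m - s)) i j = wp_matrix r k \<tau> z i j"
    unfolding wp_matrix_def using ij by (rule two_sided_shift)
  finally show ?thesis .
qed

lemma multi_wp_shift:
  assumes \<tau>: "0 < Im \<tau>" and ks: "ks \<noteq> []" "\<forall>k\<in>set ks. 2 \<le> k"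
    and zs: "length zs = length ks" "set zs \<inter> lattice \<tau> = {}" and \<omega>: "\<omega> \<in> lattice \<tau>"
  shows "multi_wp \<tau> ks (map (\<lambda>z. z + \<omega>) zs) = multi_wp \<tau> ks zs"
proof -
  let ?r = "length ks"
  have z: "zs ! a \<notin> lattice \<tau>" if "a < ?r" for a
    using that zs nth_mem[of a zs] by (metis IntI empty_iff)
  have "set (map (\<lambda>z. z + \<omega>) zs) \<inter> lattice \<tau> = {}"
    using zs lattice_diff[OF _ \<omega>] by fastforce
  then have "multi_wp \<tau> ks (map (\<lambda>z. z + \<omega>) zs)
      = wp_matrix ?r ((!) ks) \<tau> ((!) (map (\<lambda>z. z + \<omega>) zs)) 0 ?r"
    using \<tau> ks zs by (intro multi_wp_eq_wp_matrix) auto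
  also have "\<dots> = wp_matrix ?r ((!) ks) \<tau> (\<lambda>a. zs ! a + \<omega>) 0 ?r"
    by (rule wp_matrix_cong) (simp_all add: zs)
  also have "\<dots> = wp_matrix ?r ((!) ks) \<tau> ((!) zs) 0 ?r"
    using ks z \<tau> \<omega> by (intro wp_matrix_shift) auto
  also have "\<dots> = multi_wp \<tau> ks zs"
    using \<tau> ks zs by (intro multi_wp_eq_wp_matrix[symmetric])
  finally show ?thesis .
qed

lemma wp_matrix_holomorphic:
  assumes k: "\<And>a. a < r \<Longrightarrow> 2 \<le> k a" and \<tau>: "0 < Im \<tau>" and ij: "i \<le> r" "j \<le> r"
  shows "(\<lambda>z. wp_matrix r k \<tau> (\<lambda>_. z) i j) holomorphic_on - lattice \<tau>"
  unfolding wp_matrix_def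
proof (rule two_sided_holomorphic[OF _ ij])
  show op: "open (- lattice \<tau>)" using closed_lattice[OF \<tau>] by auto
  show "(\<lambda>z. wp_rows r k \<tau> (\<lambda>_. z) m i j) holomorphic_on - lattice \<tau>" if "i \<le> r" "j \<le> r" for m i j
  proof -
    have "(\<lambda>z. multitangent r k (\<lambda>_. z) i j) \<circ> (\<lambda>z. z - of_int m * \<tau>) holomorphic_on - lattice \<tau>"
      using row_not_Ints k that
      by (intro holomorphic_on_compose_gen[OF _ multitangent_holomorphic] holomorphic_intros) auto
    then show ?thesis by (simp add: wp_rows_def o_def)
  qed
  fix z0 assume "z0 \<in> - lattice \<tau>"
  from away_from_complement[OF op this] obtain d where d: "0 < d" "\<And>z w. z \<in> cball z0 d \<Longrightarrow> w \<notin> - lattice \<tau> \<Longrightarrow> d \<le> norm (z - w)"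
    by blast
  obtain C where C: "\<And>v m. (\<And>a. a < r \<Longrightarrow> norm (v a) \<le> norm z0 + d) \<Longrightarrow>
      (\<And>a n. a < r \<Longrightarrow> d \<le> norm (v a - of_int m * \<tau> - of_int n)) \<Longrightarrow>
      mnorm r (multitangent r k (\<lambda>a. v a - of_int m * \<tau>)) \<le> C * weight m"
    by (rule multitangent_rows_decay[of r k d "norm z0 + d" \<tau>]) (use k d \<tau> in auto)
  have "mnorm r (wp_rows r k \<tau> (\<lambda>_. z) m) \<le> C * weight m" if "z \<in> cball z0 d" for z m
    unfolding wp_rows_def
  proof (rule C)
    show "norm z \<le> norm z0 + d"
      using that norm_triangle_ineq2[of z z0] by (simp add: dist_norm norm_minus_commute)
    show "d \<le> norm (z - of_int m * \<tau> - of_int n)" for n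
      using d(2)[OF that, of "of_int m * \<tau> + of_int n"] by (auto simp: lattice_iff diff_diff_eq)
  qed
  then show "\<exists>d>0. \<exists>C. \<forall>z\<in>cball z0 d. \<forall>m. mnorm r (wp_rows r k \<tau> (\<lambda>_. z) m) \<le> C * weight m"
    using d(1) by blast
qed

text \<open>
  All rows but the one through \<open>0\<close>, and all points of that row but \<open>0\<close>, keep a distance from a
  small disc about \<open>0\<close>. The two singled-out factors enter linearly, so the growth is that of
  the deviation at the point \<open>0\<close>, at most \<open>r / |z|\<^bsup>K\<^esup>\<close> with \<open>K\<close> the sum of the exponents.
\<close>

lemma wp_matrix_pole_bound:
  assumes k: "\<And>a. a < r \<Longrightarrow> 2 \<le> k a" and \<tau>: "0 < Im \<tau>" and ij: "i \<le> r" "j \<le> r"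
  obtains d B K where "0 < d" "\<And>z :: complex. z \<in> ball 0 d \<Longrightarrow> z \<noteq> 0 \<Longrightarrow> z \<notin> lattice \<tau>"
    "\<And>z. z \<in> ball 0 d \<Longrightarrow> z \<noteq> 0 \<Longrightarrow> norm (z ^ K * wp_matrix r k \<tau> (\<lambda>_. z) i j) \<le> B"
proof -
  obtain \<delta> where \<delta>: "0 < \<delta>" "\<And>w. w \<in> lattice \<tau> \<Longrightarrow> w \<noteq> 0 \<Longrightarrow> \<delta> \<le> norm (0 - w)"
    using lattice_gap[OF \<tau>, of 0] by blast
  define d where "d = min 1 (\<delta> / 2)"
  have d: "0 < d" "d \<le> 1" "d \<le> \<delta> / 2" using \<delta> by (auto simp: d_def)
  define K where "K = (\<Sum>a<r. k a)"
  have away: "d \<le> norm (z - w)" if "z \<in> ball 0 d" "w \<in> lattice \<tau>" "w \<noteq> 0" for z w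
    using \<delta>(2)[OF that(2,3)] that(1) d norm_triangle_ineq2[of w z] by (simp add: norm_minus_commute)
  obtain C1 where C1: "0 \<le> C1" "\<And>v m. (\<And>a. a < r \<Longrightarrow> norm (v a) \<le> 1) \<Longrightarrow>
      (\<And>a n. a < r \<Longrightarrow> d \<le> norm (v a - of_int m * \<tau> - of_int n)) \<Longrightarrow>
      mnorm r (multitangent r k (\<lambda>a. v a - of_int m * \<tau>)) \<le> C1 * weight m"
    by (rule multitangent_rows_decay[of r k d 1 \<tau>]) (use k d \<tau> in auto)
  obtain C2 where C2: "0 \<le> C2" "\<And>(u :: nat \<Rightarrow> complex) n. (\<And>a. a < r \<Longrightarrow> norm (u a) \<le> 1) \<Longrightarrow>
      (\<And>a. a < r \<Longrightarrow> d \<le> norm (u a - of_int n)) \<Longrightarrow> mnorm r (pole_step k u n) \<le> C2 * weight n"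
    by (rule pole_step_decay[of r k d 1]) (use k d in auto)
  define B where "B = (1 + real r) * exp (3 * C2) * exp (3 * C1)"
  have bound: "norm (z ^ K * wp_matrix r k \<tau> (\<lambda>_. z) i j) \<le> B" if z: "z \<in> ball 0 d" "z \<noteq> 0" for z :: complex
  proof -
    have z1: "norm z \<le> 1" using z d by simp
    have pole: "mnorm r (pole_step k (\<lambda>_. z) 0) \<le> real r / norm z ^ K"
    proof -
      have "norm (1 / (z - of_int 0) ^ k a) \<le> 1 / norm z ^ K" if "a < r" for a
      proof -
        have "k a \<le> K" unfolding K_def by (rule member_le_sum) (use that in auto)
        then have "norm z ^ K \<le> norm z ^ k a" using z1 by (intro power_decreasing) auto
        then show ?thesis using z by (simp add: norm_divide norm_power frac_le)
      qed
      then have "mnorm r (pole_step k (\<lambda>_. z) 0) \<le> (\<Sum>a<r. 1 / norm z ^ K)"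
        unfolding pole_step_def mnorm_step_matrix by (intro sum_mono) auto
      then show ?thesis by simp
    qed
    have "mnorm r (wp_rows r k \<tau> (\<lambda>_. z) m) \<le> C1 * weight m" if "m \<noteq> 0" for m
      unfolding wp_rows_def
    proof (rule C1(2))
      fix n
      have "of_int m * \<tau> + of_int n \<noteq> 0"
        using lattice_coords_unique[OF \<tau>, of m n 0 0] that by auto
      then show "d \<le> norm (z - of_int m * \<tau> - of_int n)"
        using away[OF z(1), of "of_int m * \<tau> + of_int n"] by (auto simp: lattice_iff diff_diff_eq)
    qed (rule z1)
    then have "1 + mnorm r (wp_matrix r k \<tau> (\<lambda>_. z))
        \<le> (1 + mnorm r (wp_rows r k \<tau> (\<lambda>_. z) 0)) * exp (3 * C1)"
      unfolding wp_matrix_def using C1(1) by (rule mnorm_two_sided_le)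
    also have "mnorm r (pole_step k (\<lambda>_. z) n) \<le> C2 * weight n" if "n \<noteq> 0" for n
    proof (rule C2(2))
      have "of_int n \<in> lattice \<tau>" unfolding lattice_iff by (intro exI[of _ 0] exI[of _ n]) simp
      then show "d \<le> norm (z - of_int n)" using away[OF z(1)] that by simp
    qed (rule z1)
    then have "1 + mnorm r (wp_rows r k \<tau> (\<lambda>_. z) 0)
        \<le> (1 + mnorm r (pole_step k (\<lambda>_. z) 0)) * exp (3 * C2)"
      unfolding wp_rows_def multitangent_def using C2(1) by (simp add: mnorm_two_sided_le)
    also have "\<dots> \<le> (1 + real r / norm z ^ K) * exp (3 * C2)"
      using pole by (intro mult_right_mono) auto
    finally have "1 + mnorm r (wp_matrix r k \<tau> (\<lambda>_. z))
        \<le> (1 + real r / norm z ^ K) * exp (3 * C2) * exp (3 * C1)"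
      by (simp add: mult_right_mono)
    then have "norm (wp_matrix r k \<tau> (\<lambda>_. z) i j) \<le> (1 + real r / norm z ^ K) * exp (3 * C2) * exp (3 * C1)"
      using norm_entry_le_mnorm[OF ij, of "wp_matrix r k \<tau> (\<lambda>_. z)"] by linarith
    then have "norm z ^ K * norm (wp_matrix r k \<tau> (\<lambda>_. z) i j)
        \<le> norm z ^ K * ((1 + real r / norm z ^ K) * exp (3 * C2) * exp (3 * C1))"
      by (rule mult_left_mono) simp
    also have "\<dots> = (norm z ^ K + real r) * exp (3 * C2) * exp (3 * C1)"
      using z by (simp add: field_simps)
    also have "\<dots> \<le> B"
      unfolding B_def using z1 by (intro mult_right_mono) (auto simp: power_le_one)
    finally show ?thesis by (simp add: norm_mult norm_power)
  qed
  show ?thesis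
  proof (rule that[OF d(1) _ bound])
    fix z :: complex assume "z \<in> ball 0 d" "z \<noteq> 0"
    then show "z \<notin> lattice \<tau>" using away[of z z] d by auto
  qed
qed

text \<open>
  Multiplication by a power of \<open>z\<close> makes the singularity removable.
\<close>

lemma wp_matrix_meromorphic_at_0:
  assumes k: "\<And>a. a < r \<Longrightarrow> 2 \<le> k a" and \<tau>: "0 < Im \<tau>" and ij: "i \<le> r" "j \<le> r"
  shows "(\<lambda>z. wp_matrix r k \<tau> (\<lambda>_. z) i j) meromorphic_on {0}"
proof -
  define f where "f z = wp_matrix r k \<tau> (\<lambda>_. z) i j" for z
  obtain d B K where d: "0 < d" "\<And>z :: complex. z \<in> ball 0 d \<Longrightarrow> z \<noteq> 0 \<Longrightarrow> z \<notin> lattice \<tau>"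
    "\<And>z. z \<in> ball 0 d \<Longrightarrow> z \<noteq> 0 \<Longrightarrow> norm (z ^ K * f z) \<le> B"
    unfolding f_def by (rule wp_matrix_pole_bound[of r k \<tau> i j]) (use assms in auto)
  have "f holomorphic_on ball 0 d - {0}"
    unfolding f_def using d(2) by (intro holomorphic_on_subset[OF wp_matrix_holomorphic[OF k \<tau> ij]]) auto
  then have hol: "(\<lambda>z. z ^ K * f z) holomorphic_on ball 0 d - {0}"
    by (intro holomorphic_intros)
  have punctured: "eventually (\<lambda>z. z \<in> ball 0 d - {0}) (at (0 :: complex))"
    by (rule eventually_at_in_open) (use d in auto)
  have "\<exists>B. eventually (\<lambda>z. norm (z ^ K * f z) \<le> B) (at 0)"
    using punctured by (intro exI[of _ B], elim eventually_mono) (use d in auto)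
  then obtain g where g: "g holomorphic_on ball 0 d" "\<And>z. z \<in> ball 0 d - {0} \<Longrightarrow> g z = z ^ K * f z"
    using holomorphic_on_extend_bounded[OF hol, of] d(1) by auto
  have "g analytic_on {0}"
    using g(1) d(1) by (auto simp: analytic_at intro: exI[of _ "ball 0 d"])
  then have "(\<lambda>z. g z / z ^ K) meromorphic_on {0}"
    by (intro meromorphic_intros analytic_on_imp_meromorphic_on)
  also have "?this \<longleftrightarrow> f meromorphic_on {0}"
    using punctured g(2) by (intro meromorphic_on_cong) (auto elim!: eventually_mono)
  finally show ?thesis by (simp only: f_def[abs_def])
qed

lemma multi_wp1_eq_wp_matrix:
  assumes "0 < Im \<tau>" "ks \<noteq> []" "\<forall>k\<in>set ks. 2 \<le> k" "z \<notin> lattice \<tau>"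
  shows "multi_wp1 \<tau> ks z = wp_matrix (length ks) ((!) ks) \<tau> (\<lambda>_. z) 0 (length ks)"
proof -
  let ?r = "length ks" and ?zs = "replicate (length ks) z"
  have "multi_wp1 \<tau> ks z = wp_matrix ?r ((!) ks) \<tau> ((!) ?zs) 0 ?r"
    unfolding multi_wp1_def using assms by (intro multi_wp_eq_wp_matrix) auto
  also have "\<dots> = wp_matrix ?r ((!) ks) \<tau> (\<lambda>_. z) 0 ?r"
    by (rule wp_matrix_cong) simp_all
  finally show ?thesis .
qed

theorem lemma2p5:
  fixes \<tau> :: complex and r :: nat and ks :: "nat list"
  assumes "Im \<tau> > 0" and "r \<ge> 1" and "length ks = r" and "\<forall>k\<in>set ks. k \<ge> 2"
  shows "(\<forall>\<omega>\<in>lattice \<tau>. \<forall>zs. length zs = r \<and> set zs \<inter> lattice \<tau> = {} \<longrightarrow>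
            multi_wp \<tau> ks (map (\<lambda>z. z + \<omega>) zs) = multi_wp \<tau> ks zs) \<and>
         multi_wp1 \<tau> ks holomorphic_on (- lattice \<tau>) \<and>
         multi_wp1 \<tau> ks meromorphic_on UNIV \<and>
         (\<forall>z. z \<notin> lattice \<tau> \<longrightarrow>
            multi_wp1 \<tau> ks (z + 1) = multi_wp1 \<tau> ks z \<and>
            multi_wp1 \<tau> ks (z + \<tau>) = multi_wp1 \<tau> ks z)"
proof -
  note \<tau> = assms(1) and ks2 = assms(4)
  have ks: "ks \<noteq> []" using assms by auto
  let ?f = "multi_wp1 \<tau> ks" and ?g = "\<lambda>z. wp_matrix r ((!) ks) \<tau> (\<lambda>_. z) 0 r"
  have fg: "?f z = ?g z" if "z \<notin> lattice \<tau>" for z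
    using multi_wp1_eq_wp_matrix[OF \<tau> ks ks2 that] assms by simp
  have shift: "multi_wp \<tau> ks (map (\<lambda>z. z + \<omega>) zs) = multi_wp \<tau> ks zs"
    if "\<omega> \<in> lattice \<tau>" "length zs = r" "set zs \<inter> lattice \<tau> = {}" for \<omega> zs
    using multi_wp_shift[OF \<tau> ks ks2] that assms by simp
  have shift1: "?f (z + \<omega>) = ?f z" if "\<omega> \<in> lattice \<tau>" "z \<notin> lattice \<tau>" for z \<omega>
    using shift[of \<omega> "replicate r z"] that assms by (auto simp: multi_wp1_def)
  have "?g holomorphic_on - lattice \<tau>"
    using assms by (intro wp_matrix_holomorphic) auto
  then have hol: "?f holomorphic_on - lattice \<tau>"
    by (rule holomorphic_transform) (simp add: fg)
  have op: "open (- lattice \<tau>)" using closed_lattice[OF \<tau>] by auto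
  have isolated: "eventually (\<lambda>z. z \<notin> lattice \<tau>) (at z0)" for z0
  proof -
    obtain \<delta> where \<delta>: "0 < \<delta>" "\<And>w. w \<in> lattice \<tau> \<Longrightarrow> w \<noteq> z0 \<Longrightarrow> \<delta> \<le> norm (z0 - w)"
      using lattice_gap[OF \<tau>] by blast
    have "z \<notin> lattice \<tau>" if "z \<noteq> z0" "dist z z0 < \<delta>" for z
      using \<delta>(2)[of z] that by (auto simp: dist_norm norm_minus_commute)
    then show ?thesis
      unfolding eventually_at using \<delta>(1) by blast
  qed
  have mero: "?f meromorphic_on {z0}" for z0
  proof (cases "z0 \<in> lattice \<tau>")
    case False
    have "?f analytic_on - lattice \<tau>" using hol op by (simp add: analytic_on_open)
    then have "?f analytic_on {z0}" by (rule analytic_on_subset) (use False in auto)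
    then show ?thesis by (rule analytic_on_imp_meromorphic_on)
  next
    case True
    have "?g meromorphic_on {0}"
      using assms by (intro wp_matrix_meromorphic_at_0) auto
    then have "(\<lambda>z. ?g (z - z0)) meromorphic_on {z0}"
      by (rule meromorphic_on_compose) (auto intro!: analytic_intros)
    moreover have "eventually (\<lambda>z. ?g (z - z0) = ?f z) (at z0)"
      using isolated[of z0]
    proof eventually_elim
      case (elim z)
      have "z - z0 \<notin> lattice \<tau>" using lattice_add[OF _ True, of "z - z0"] elim by auto
      then show ?case using shift1[OF True, of "z - z0"] fg[of "z - z0"] by simp
    qed
    then have "(\<lambda>z. ?g (z - z0)) meromorphic_on {z0} \<longleftrightarrow> ?f meromorphic_on {z0}"
      by (intro meromorphic_on_cong) auto
    ultimately show ?thesis by simp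
  qed
  then have "?f meromorphic_on UNIV"
    using meromorphic_on_meromorphic_at by blast
  moreover have "1 \<in> lattice \<tau>" "\<tau> \<in> lattice \<tau>"
    unfolding lattice_iff by (rule exI[of _ 0], rule exI[of _ 1], simp, rule exI[of _ 1], rule exI[of _ 0], simp)
  ultimately show ?thesis using shift shift1 hol by blast
qed

end
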